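(* Let $\mathcal{C}$ be a sum closed permutation class with $f_n=|\mathcal{C}_n|$, $\widetilde f_n=|\oplus\mathcal{C}_n|$, and $g_n$ the number of sum-indecomposable permutations in $\mathcal{C}_n$. Let $G(x)=\sum_{n\ge1}g_nx^n$, let $r$ be its radius of convergence, and let $\tau=\lim_{x\to r^-}G(x)$. Assume: - $\tau<1$ (subcritical); - as a complex function, $G(z)$ has no singularity on its closed disc of convergence other than $z=r$; - there are $\epsilon>0$, a closed triangle $T$ symmetric about the real axis with left vertex at $z=r$, and constants $c>0$ and $0<\lambda<1$ such that $G$ extends analytically to $D\setminus T$, where $D=\{|z|<r+\epsilon\}$, and $G(z)=\tau-(c+o(1))(1-z/r)^{\lambda}$ there. Then $\widetilde f_n\sim(1-\tau)\,n\,f_n$ and $g_n\sim(1-\tau)^2f_n$ as $n\to\infty$.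
   Context: A permutation class is a set of finite permutations closed under containment; $\mathcal{C}_n=\mathcal{C}\cap S_n$. The sum $\sigma\oplus\tau$ of $\sigma\in S_a$ and $\tau\in S_b$ equals $\sigma(i)$ for $i\le a$ and $a+\tau(i-a)$ for $i>a$. A class is sum closed if it is closed under $\oplus$. A permutation is sum-indecomposable if it is not a sum of two permutations of nonzero size. For $\pi\in S_n$, $\oplus\pi(i+kn)=\pi(i)+kn$ for $i\in[n]$ and $k\in\mathbb{Z}$. The shift is $\Sigma^r\sigma(i)=\sigma(i-r)+r$. We set $\oplus\mathcal{C}_n=\{\Sigma^r(\oplus\pi):\pi\in\mathcal{C}_n,\ r\in\mathbb{Z}\}$. *)

theory Defs
  imports
    "HOL-Complex_Analysis.Complex_Analysis"
    "HOL-Combinatorics.Permutations"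
    "HOL-Library.Landau_Symbols"
begin

unbundle asymp_equiv_syntax

text \<open>
  A permutation of size \<open>n\<close> is a function \<open>\<pi> :: nat \<Rightarrow> nat\<close> with \<open>\<pi> permutes {1..n}\<close>. Such a function
  fixes everything outside \<open>{1..n}\<close> and so does not determine \<open>n\<close>; sizes are therefore
  passed explicitly, and a set of finite permutations is a family \<open>C\<close> whose member \<open>C n\<close> is its
  set of permutations of size \<open>n\<close>.
\<close>

type_synonym perm_family = "nat \<Rightarrow> (nat \<Rightarrow> nat) set"

text \<open>\<open>\<sigma>\<close> of size \<open>k\<close> is contained in \<open>\<pi>\<close> of size \<open>n\<close>; \<open>e\<close> gives the positions of the occurrence.\<close>

definition perm_contained :: "nat \<Rightarrow> (nat \<Rightarrow> nat) \<Rightarrow> nat \<Rightarrow> (nat \<Rightarrow> nat) \<Rightarrow> bool" where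
  "perm_contained k \<sigma> n \<pi> \<longleftrightarrow>
     (\<exists>e. strict_mono_on {1..k} e \<and> e ` {1..k} \<subseteq> {1..n} \<and>
          (\<forall>i\<in>{1..k}. \<forall>j\<in>{1..k}. \<sigma> i < \<sigma> j \<longleftrightarrow> \<pi> (e i) < \<pi> (e j)))"

definition permutation_class :: "perm_family \<Rightarrow> bool" where
  "permutation_class C \<longleftrightarrow>
     (\<forall>n. \<forall>\<pi>\<in>C n. \<pi> permutes {1..n}) \<and>
     (\<forall>n k \<pi> \<sigma>. \<pi> \<in> C n \<longrightarrow> \<sigma> permutes {1..k} \<longrightarrow> perm_contained k \<sigma> n \<pi> \<longrightarrow> \<sigma> \<in> C k)"

text \<open>The sum of \<open>\<sigma>\<close>, of size \<open>a\<close>, and \<open>\<tau>\<close>, of any size.\<close>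

definition perm_sum :: "nat \<Rightarrow> (nat \<Rightarrow> nat) \<Rightarrow> (nat \<Rightarrow> nat) \<Rightarrow> nat \<Rightarrow> nat" where
  "perm_sum a \<sigma> \<tau> = (\<lambda>i. if i \<le> a then \<sigma> i else a + \<tau> (i - a))"

definition sum_closed :: "perm_family \<Rightarrow> bool" where
  "sum_closed C \<longleftrightarrow> (\<forall>a b. \<forall>\<sigma>\<in>C a. \<forall>\<tau>\<in>C b. perm_sum a \<sigma> \<tau> \<in> C (a + b))"

definition sum_indecomposable :: "nat \<Rightarrow> (nat \<Rightarrow> nat) \<Rightarrow> bool" where
  "sum_indecomposable n \<pi> \<longleftrightarrow>
     \<not> (\<exists>a b \<sigma> \<tau>. a > 0 \<and> b > 0 \<and> a + b = n \<and>
          \<sigma> permutes {1..a} \<and> \<tau> permutes {1..b} \<and> \<pi> = perm_sum a \<sigma> \<tau>)"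

definition indecomposables :: "perm_family \<Rightarrow> perm_family" where
  "indecomposables C n = {\<pi> \<in> C n. sum_indecomposable n \<pi>}"

text \<open>
  The infinite sum of copies of \<open>\<pi>\<close>, of size \<open>n\<close>: every integer is uniquely \<open>i + k * n\<close> with
  \<open>i \<in> {1..n}\<close>, see the lemma below. The value for \<open>n = 0\<close> is meaningless.
\<close>

definition periodic_sum :: "nat \<Rightarrow> (nat \<Rightarrow> nat) \<Rightarrow> int \<Rightarrow> int" where
  "periodic_sum n \<pi> j = int (\<pi> (nat ((j - 1) mod int n + 1))) + (j - 1) div int n * int n"

lemma periodic_sum_eq:
  assumes "i \<in> {1..n}"
  shows "periodic_sum n \<pi> (int i + k * int n) = int (\<pi> i) + k * int n"
proof -
  have eq: "int i + k * int n - 1 = (int i - 1) + k * int n" by simp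
  have "(int i - 1 + k * int n) mod int n = int i - 1"
    and "(int i - 1 + k * int n) div int n = k"
    using assms by (simp_all add: div_pos_pos_trivial)
  then show ?thesis by (simp add: periodic_sum_def eq)
qed

definition shift :: "int \<Rightarrow> (int \<Rightarrow> int) \<Rightarrow> int \<Rightarrow> int" where
  "shift r \<sigma> = (\<lambda>i. \<sigma> (i - r) + r)"

definition periodic_sums :: "perm_family \<Rightarrow> nat \<Rightarrow> (int \<Rightarrow> int) set" where
  "periodic_sums C n = {shift r (periodic_sum n \<pi>) | \<pi> r. \<pi> \<in> C n}"

text \<open>The empty permutation is not counted: the generating function starts at \<open>n = 1\<close>.\<close>

definition indec_gf :: "perm_family \<Rightarrow> complex fps" where
  "indec_gf C = Abs_fps (\<lambda>n. if n = 0 then 0 else of_nat (card (indecomposables C n)))"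

text \<open>
  \<open>z\<close> is not a singularity of the function given by \<open>F\<close> on its disc of convergence, that is, this
  function continues analytically to a neighbourhood of \<open>z\<close>. Meaningful only for \<open>z\<close> in the closed
  disc of convergence: elsewhere small balls miss the disc and the condition is vacuous.
\<close>

definition fps_regular_at :: "complex fps \<Rightarrow> complex \<Rightarrow> bool" where
  "fps_regular_at F z \<longleftrightarrow>
     (\<exists>d>0. \<exists>h. h analytic_on ball z d \<and>
        (\<forall>w \<in> ball z d \<inter> eball 0 (fps_conv_radius F). h w = eval_fps F w))"

text \<open>
  For \<open>r < a\<close> and \<open>0 < b\<close>, these are the closed nondegenerate triangles symmetric about the
  real axis whose left vertex is \<open>r\<close>.
\<close>

definition sym_triangle :: "real \<Rightarrow> real \<Rightarrow> real \<Rightarrow> complex set" where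
  "sym_triangle r a b = convex hull {complex_of_real r, Complex a b, Complex a (- b)}"

end

theory Submission
  imports Defs "HOL-Real_Asymp.Real_Asymp"
begin

text \<open>
  Write \<open>F = \<Sum> f\<^sub>n x\<^sup>n\<close>, \<open>P = \<Sum> p\<^sub>n x\<^sup>n\<close> for the periodic sums \<open>p\<^sub>n\<close>, and \<open>a\<^sub>n = g\<^sub>n r\<^sup>n\<close>. Splitting off the
  first sum-indecomposable block gives \<open>F = 1 + G F\<close>; marking the block of a periodic sum that
  straddles the origin, together with the position of the origin in it, gives \<open>P = x G' F\<close>.

  The difference of \<open>G(r z)\<close> and its singular expansion \<open>\<tau> - c (1 - z)\<^sup>\<lambda>\<close> is \<open>o((1 - z)\<^sup>\<lambda>)\<close> in a region
  containing a disc of radius proportional to \<open>|1 - z|\<close> around every \<open>z\<close> of the unit disc near \<open>1\<close>.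
  Cauchy's inequality bounds its third derivative by \<open>o(|1 - z| powr (\<lambda> - 3))\<close>, and integrating over the
  circle of radius \<open>1 - 1/n\<close> bounds its coefficients by \<open>o(n powr (- 1 - \<lambda>))\<close>. No contour has to leave
  the unit disc. Hence \<open>a\<^sub>n\<close> is asymptotic to \<open>K n powr (- 1 - \<lambda>)\<close> with \<open>K = - c / \<Gamma>(- \<lambda>)\<close>.

  Since \<open>x F' = x G' F\<^sup>2\<close>, both \<open>n f\<^sub>n\<close> and \<open>p\<^sub>n\<close> are convolutions of the regularly varying \<open>n g\<^sub>n\<close> with a
  summable sequence, \<open>F\<^sup>2\<close> respectively \<open>F\<close>, and only the sums \<open>1 / (1 - \<tau>)\<^sup>2\<close> and \<open>1 / (1 - \<tau>)\<close> of the
  latter matter.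
\<close>

section \<open>Cuts and first blocks\<close>

text \<open>Polymorphic, to serve permutations on \<open>nat\<close> and periodic sums on
  \<open>int\<close> alike. For a permutation of size \<open>n\<close>, the number \<open>0\<close>
  and all numbers from \<open>n\<close> on are trivial cuts; the others are the points where it
  splits as a sum.\<close>

definition cut_at :: "('a::linorder \<Rightarrow> 'a) \<Rightarrow> 'a \<Rightarrow> bool" where
  "cut_at s p \<longleftrightarrow> (\<forall>i. s i \<le> p \<longleftrightarrow> i \<le> p)"

text \<open>The size of the first sum-indecomposable block. For \<open>0 < n\<close> the trivial cut
  \<open>n\<close> makes the \<open>LEAST\<close> meaningful.\<close>

definition first_cut :: "(nat \<Rightarrow> nat) \<Rightarrow> nat" where
  "first_cut \<pi> = (LEAST k. 0 < k \<and> cut_at \<pi> k)"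

definition left_part :: "nat \<Rightarrow> (nat \<Rightarrow> nat) \<Rightarrow> nat \<Rightarrow> nat" where
  "left_part a \<pi> = (\<lambda>i. if i \<le> a then \<pi> i else i)"

definition right_part :: "nat \<Rightarrow> (nat \<Rightarrow> nat) \<Rightarrow> nat \<Rightarrow> nat" where
  "right_part a \<pi> = (\<lambda>i. \<pi> (i + a) - a)"

lemma cut_atD: "cut_at s p \<Longrightarrow> s i \<le> p \<longleftrightarrow> i \<le> p"
  by (simp add: cut_at_def)

lemma permutes_atLeastAtMost_le:
  fixes \<pi> :: "nat \<Rightarrow> nat"
  assumes "\<pi> permutes {1..n}" shows "\<pi> i \<le> n \<longleftrightarrow> i \<le> n"
  using permutes_in_image[OF assms, of i] permutes_not_in[OF assms, of i] by force

lemma permutes_atLeastAtMost_0: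
  fixes \<pi> :: "nat \<Rightarrow> nat"
  assumes "\<pi> permutes {1..n}" shows "\<pi> i = 0 \<longleftrightarrow> i = 0"
  using permutes_in_image[OF assms, of i] permutes_not_in[OF assms, of i] by force

lemma cut_size:
  fixes \<pi> :: "nat \<Rightarrow> nat"
  assumes "\<pi> permutes {1..n}" shows "cut_at \<pi> n"
  using permutes_atLeastAtMost_le[OF assms] by (simp add: cut_at_def)

lemma permutes_of_inj:
  fixes p :: "nat \<Rightarrow> nat"
  assumes "inj_on p {1..n}" "\<And>i. i \<in> {1..n} \<Longrightarrow> p i \<in> {1..n}" "\<And>i. i \<notin> {1..n} \<Longrightarrow> p i = i"
  shows "p permutes {1..n}"
proof (rule bij_imp_permutes)
  show "bij_betw p {1..n} {1..n}"
    using assms by (metis bij_betw_def endo_inj_surj finite_atLeastAtMost image_subsetI)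
qed (use assms in auto)

lemma left_part_permutes:
  assumes "\<pi> permutes {1..n}" "cut_at \<pi> a"
  shows "left_part a \<pi> permutes {1..a}"
proof (rule permutes_of_inj)
  show "inj_on (left_part a \<pi>) {1..a}"
    using permutes_inj[OF assms(1)] by (auto simp: inj_on_def left_part_def inj_def)
next
  fix i assume "i \<in> {1..a}"
  then show "left_part a \<pi> i \<in> {1..a}"
    using cut_atD[OF assms(2), of i] permutes_atLeastAtMost_0[OF assms(1), of i]
    by (auto simp: left_part_def)
next
  fix i assume "i \<notin> {1..a}"
  then show "left_part a \<pi> i = i"
    using permutes_atLeastAtMost_0[OF assms(1), of i] by (auto simp: left_part_def)
qed

lemma right_part_permutes:
  assumes "\<pi> permutes {1..n}" "cut_at \<pi> a" "a \<le> n"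
  shows "right_part a \<pi> permutes {1..n - a}"
proof (rule permutes_of_inj)
  have gt: "\<pi> (i + a) > a" if "i \<in> {1..n-a}" for i
    using that cut_atD[OF assms(2), of "i + a"] by auto
  show "inj_on (right_part a \<pi>) {1..n - a}"
  proof (rule inj_onI)
    fix i j assume ij: "i \<in> {1..n-a}" "j \<in> {1..n-a}" and "right_part a \<pi> i = right_part a \<pi> j"
    then have "\<pi> (i + a) = \<pi> (j + a)"
      using gt[OF ij(1)] gt[OF ij(2)] by (simp add: right_part_def)
    then show "i = j" using permutes_inj[OF assms(1)] by (metis add_right_cancel injD)
  qed
  show "right_part a \<pi> i \<in> {1..n-a}" if "i \<in> {1..n-a}" for i
    using that gt[OF that] permutes_atLeastAtMost_le[OF assms(1), of "i + a"] assms(3)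
    by (auto simp: right_part_def)
  show "right_part a \<pi> i = i" if "i \<notin> {1..n-a}" for i
  proof (cases "i = 0")
    case True
    \<comment> \<open>The value is \<open>\<pi> a - a\<close>, which truncates to \<open>0\<close>
      because \<open>\<pi> a \<le> a\<close> at a cut.\<close>
    then show ?thesis using cut_atD[OF assms(2), of a] by (simp add: right_part_def)
  next
    case False
    then have "i + a \<notin> {1..n}" using that by auto
    then show ?thesis using permutes_not_in[OF assms(1)] by (simp add: right_part_def)
  qed
qed

lemma perm_sum_parts:
  assumes "cut_at \<pi> a"
  shows "perm_sum a (left_part a \<pi>) (right_part a \<pi>) = \<pi>"
proof
  fix i show "perm_sum a (left_part a \<pi>) (right_part a \<pi>) i = \<pi> i"
    using cut_atD[OF assms, of i] by (auto simp: perm_sum_def left_part_def right_part_def)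
qed

lemma left_part_perm_sum:
  assumes "\<sigma> permutes {1..a}"
  shows "left_part a (perm_sum a \<sigma> \<tau>) = \<sigma>"
  using permutes_not_in[OF assms] by (auto simp: perm_sum_def left_part_def)

lemma right_part_perm_sum:
  assumes "\<sigma> permutes {1..a}" "\<tau> permutes {1..b}"
  shows "right_part a (perm_sum a \<sigma> \<tau>) = \<tau>"
proof
  fix i show "right_part a (perm_sum a \<sigma> \<tau>) i = \<tau> i"
    using cut_atD[OF cut_size[OF assms(1)], of a] permutes_atLeastAtMost_0[OF assms(2), of 0]
    by (auto simp: perm_sum_def right_part_def)
qed

lemma cut_perm_sum:
  assumes "\<sigma> permutes {1..a}" "\<tau> permutes {1..b}"
  shows "cut_at (perm_sum a \<sigma> \<tau>) a"
  using cut_atD[OF cut_size[OF assms(1)]] permutes_atLeastAtMost_0[OF assms(2)]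
  by (auto simp: cut_at_def perm_sum_def)

text \<open>Beyond position \<open>a\<close> both maps take values at least \<open>a\<close>, hence
  above \<open>k\<close>, so the second summand has no influence on cuts strictly inside the
  first.\<close>

lemma cut_perm_sum_iff:
  assumes "\<sigma> permutes {1..a}" "\<tau> permutes {1..b}" "k < a"
  shows "cut_at (perm_sum a \<sigma> \<tau>) k \<longleftrightarrow> cut_at \<sigma> k"
proof -
  have "perm_sum a \<sigma> \<tau> i \<le> k \<longleftrightarrow> \<sigma> i \<le> k" for i
    using assms(3) permutes_not_in[OF assms(1), of i] by (auto simp: perm_sum_def)
  then show ?thesis by (simp add: cut_at_def)
qed

text \<open>The size of the first summand is a cut, and conversely the left and right parts at a cut
  strictly between \<open>0\<close> and \<open>n\<close> are two summands of nonzero size.\<close>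

lemma sum_indecomposable_iff_cut:
  assumes "\<pi> permutes {1..n}"
  shows "sum_indecomposable n \<pi> \<longleftrightarrow> \<not> (\<exists>a. 0 < a \<and> a < n \<and> cut_at \<pi> a)"
proof -
  have "(\<exists>a b \<sigma> \<tau>. a > 0 \<and> b > 0 \<and> a + b = n \<and> \<sigma> permutes {1..a} \<and> \<tau> permutes {1..b} \<and>
           \<pi> = perm_sum a \<sigma> \<tau>) \<longleftrightarrow> (\<exists>a. 0 < a \<and> a < n \<and> cut_at \<pi> a)" (is "?L \<longleftrightarrow> ?R")
  proof
    assume ?L then show ?R using cut_perm_sum by (metis less_add_same_cancel1)
  next
    assume ?R
    then obtain a where a: "0 < a" "a < n" "cut_at \<pi> a" by blast
    show ?L
      by (rule exI[of _ a], rule exI[of _ "n - a"], rule exI[of _ "left_part a \<pi>"],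
          rule exI[of _ "right_part a \<pi>"])
         (use a assms left_part_permutes right_part_permutes perm_sum_parts in auto)
  qed
  then show ?thesis by (simp add: sum_indecomposable_def)
qed

lemma first_cut:
  assumes "\<pi> permutes {1..n}" "0 < n"
  shows "0 < first_cut \<pi>" "cut_at \<pi> (first_cut \<pi>)" "first_cut \<pi> \<le> n"
proof -
  have n: "0 < n \<and> cut_at \<pi> n" using assms cut_size by blast
  show "0 < first_cut \<pi>" "cut_at \<pi> (first_cut \<pi>)"
    using LeastI[of "\<lambda>k. 0 < k \<and> cut_at \<pi> k", OF n] by (auto simp: first_cut_def)
  show "first_cut \<pi> \<le> n" using n by (auto simp: first_cut_def intro: Least_le)
qed

lemma not_cut_below_first_cut: "0 < k \<Longrightarrow> k < first_cut \<pi> \<Longrightarrow> \<not> cut_at \<pi> k"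
  using not_less_Least by (auto simp: first_cut_def)

lemma first_cut_eqI:
  assumes "0 < k" "cut_at \<pi> k" "\<And>a. 0 < a \<Longrightarrow> a < k \<Longrightarrow> \<not> cut_at \<pi> a"
  shows "first_cut \<pi> = k"
  unfolding first_cut_def
  by (rule Least_equality) (use assms in \<open>auto intro: leI\<close>)

lemma first_cut_perm_sum:
  assumes "\<sigma> permutes {1..k}" "\<tau> permutes {1..b}" "0 < k" "sum_indecomposable k \<sigma>"
  shows "first_cut (perm_sum k \<sigma> \<tau>) = k"
  using assms sum_indecomposable_iff_cut[OF assms(1)]
  by (intro first_cut_eqI) (auto simp: cut_perm_sum cut_perm_sum_iff)

text \<open>An interior cut of the left part would be a cut of \<open>\<pi>\<close>, against the
  minimality of \<open>first_cut \<pi>\<close>.\<close>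

lemma left_part_first_cut_indecomposable:
  assumes "\<pi> permutes {1..n}" "0 < n"
  shows "sum_indecomposable (first_cut \<pi>) (left_part (first_cut \<pi>) \<pi>)"
proof -
  let ?k = "first_cut \<pi>"
  note fc = first_cut[OF assms]
  note perms = left_part_permutes[OF assms(1) fc(2)] right_part_permutes[OF assms(1) fc(2,3)]
  have "cut_at (left_part ?k \<pi>) a \<longleftrightarrow> cut_at \<pi> a" if "a < ?k" for a
    using cut_perm_sum_iff[OF perms that] perm_sum_parts[OF fc(2)] by simp
  then show ?thesis
    using sum_indecomposable_iff_cut[OF perms(1)] not_cut_below_first_cut by blast
qed

section \<open>Counting a sum closed class by its first block\<close>

locale sum_closed_class =
  fixes C :: perm_family
  assumes perm_class: "permutation_class C" and closed: "sum_closed C"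
begin

lemma permutes: "\<pi> \<in> C n \<Longrightarrow> \<pi> permutes {1..n}"
  using perm_class by (simp add: permutation_class_def)

lemma containedI: "\<pi> \<in> C n \<Longrightarrow> \<sigma> permutes {1..k} \<Longrightarrow> perm_contained k \<sigma> n \<pi> \<Longrightarrow> \<sigma> \<in> C k"
  using perm_class unfolding permutation_class_def by blast

lemma perm_sum_in: "\<sigma> \<in> C a \<Longrightarrow> \<tau> \<in> C b \<Longrightarrow> perm_sum a \<sigma> \<tau> \<in> C (a + b)"
  using closed by (simp add: sum_closed_def)

lemma finite_C: "finite (C n)"
  by (rule finite_subset[OF _ finite_permutations[of "{1..n}"]]) (use permutes in auto)

lemma left_part_in:
  assumes "\<pi> \<in> C n" "cut_at \<pi> a" "a \<le> n"
  shows "left_part a \<pi> \<in> C a"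
proof (rule containedI[OF assms(1) left_part_permutes[OF permutes[OF assms(1)] assms(2)]])
  show "perm_contained a (left_part a \<pi>) n \<pi>"
    unfolding perm_contained_def
    by (rule exI[of _ id]) (use assms(3) in \<open>auto simp: strict_mono_on_def left_part_def\<close>)
qed

lemma right_part_in:
  assumes "\<pi> \<in> C n" "cut_at \<pi> a" "a \<le> n"
  shows "right_part a \<pi> \<in> C (n - a)"
proof (rule containedI[OF assms(1) right_part_permutes[OF permutes[OF assms(1)] assms(2,3)]])
  \<comment> \<open>Values to the right of the cut exceed \<open>a\<close>, so the truncated
    subtraction in \<open>right_part\<close> preserves their order.\<close>
  have "\<pi> (i + a) > a" if "i \<ge> 1" for i
    using that cut_atD[OF assms(2), of "i + a"] by auto
  then have "right_part a \<pi> i < right_part a \<pi> j \<longleftrightarrow> \<pi> (i + a) < \<pi> (j + a)"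
    if "i \<ge> 1" "j \<ge> 1" for i j
    using that by (force simp: right_part_def)
  then show "perm_contained (n - a) (right_part a \<pi>) n \<pi>"
    unfolding perm_contained_def
    by (intro exI[of _ "\<lambda>i. i + a"]) (use assms(3) in \<open>auto simp: strict_mono_on_def\<close>)
qed

text \<open>The empty permutation is contained in every permutation. Some member has to exist,
  because the empty family also satisfies the closure conditions.\<close>

lemma card_C_0:
  assumes "C n \<noteq> {}"
  shows "card (C 0) = 1"
proof -
  obtain \<pi> where \<pi>: "\<pi> \<in> C n" using assms by blast
  have "id \<in> C 0"
    by (rule containedI[OF \<pi>]) (auto simp: perm_contained_def strict_mono_on_def permutes_id)
  moreover have "\<pi> = id" if "\<pi> \<in> C 0" for \<pi> using permutes[OF that] by simp
  ultimately have "C 0 = {id}" by blast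
  then show ?thesis by simp
qed

text \<open>The combinatorial content of \<open>F = 1 + G F\<close>: splitting at the first cut
  inverts the sum, since an indecomposable first summand of size \<open>k\<close> makes
  \<open>k\<close> the first cut.\<close>

lemma bij_betw_perm_sum:
  assumes "0 < k" "k \<le> n"
  shows "bij_betw (\<lambda>(\<sigma>, \<tau>). perm_sum k \<sigma> \<tau>) (indecomposables C k \<times> C (n - k))
           {\<pi> \<in> C n. first_cut \<pi> = k}"
proof (rule bij_betw_byWitness[of _ "\<lambda>\<pi>. (left_part k \<pi>, right_part k \<pi>)"])
  show "\<forall>x\<in>indecomposables C k \<times> C (n - k). (\<lambda>\<pi>. (left_part k \<pi>, right_part k \<pi>))
          ((\<lambda>(\<sigma>, \<tau>). perm_sum k \<sigma> \<tau>) x) = x"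
    by (auto simp: indecomposables_def left_part_perm_sum[OF permutes]
          right_part_perm_sum[OF permutes permutes])
  have fc: "cut_at \<pi> k" if "\<pi> \<in> C n" "first_cut \<pi> = k" for \<pi>
    using first_cut(2)[OF permutes[OF that(1)]] that assms by auto
  show "\<forall>\<pi>\<in>{\<pi> \<in> C n. first_cut \<pi> = k}. (\<lambda>(\<sigma>, \<tau>). perm_sum k \<sigma> \<tau>)
          (left_part k \<pi>, right_part k \<pi>) = \<pi>"
    using fc perm_sum_parts by auto
  show "(\<lambda>(\<sigma>, \<tau>). perm_sum k \<sigma> \<tau>) ` (indecomposables C k \<times> C (n - k))
          \<subseteq> {\<pi> \<in> C n. first_cut \<pi> = k}"
  proof clarify
    fix \<sigma> \<tau> assume *: "\<sigma> \<in> indecomposables C k" "\<tau> \<in> C (n - k)"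
    then have \<sigma>: "\<sigma> \<in> C k" "sum_indecomposable k \<sigma>" by (auto simp: indecomposables_def)
    show "perm_sum k \<sigma> \<tau> \<in> C n \<and> first_cut (perm_sum k \<sigma> \<tau>) = k"
      using perm_sum_in[OF \<sigma>(1) *(2)] assms
        first_cut_perm_sum[OF permutes[OF \<sigma>(1)] permutes[OF *(2)] assms(1) \<sigma>(2)] by simp
  qed
  show "(\<lambda>\<pi>. (left_part k \<pi>, right_part k \<pi>)) ` {\<pi> \<in> C n. first_cut \<pi> = k}
          \<subseteq> indecomposables C k \<times> C (n - k)"
  proof clarify
    fix \<pi> assume \<pi>: "\<pi> \<in> C n" "k = first_cut \<pi>"
    then have "cut_at \<pi> k" "sum_indecomposable k (left_part k \<pi>)"
      using fc left_part_first_cut_indecomposable[OF permutes] assms by auto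
    then show "left_part (first_cut \<pi>) \<pi> \<in> indecomposables C (first_cut \<pi>) \<and>
        right_part (first_cut \<pi>) \<pi> \<in> C (n - first_cut \<pi>)"
      using left_part_in right_part_in \<pi> assms by (simp add: indecomposables_def)
  qed
qed

lemma card_first_cut:
  assumes "0 < k" "k \<le> n"
  shows "card {\<pi> \<in> C n. first_cut \<pi> = k} = card (indecomposables C k) * card (C (n - k))"
  using bij_betw_same_card[OF bij_betw_perm_sum[OF assms]] by (simp add: card_cartesian_product)

text \<open>The weight \<open>h\<close> allows two uses: constant \<open>1\<close> gives the
  recurrence for the class, the identity gives the number of periodic sums.\<close>

lemma sum_first_cut:
  fixes h :: "nat \<Rightarrow> nat"
  assumes "0 < n"
  shows "(\<Sum>\<pi>\<in>C n. h (first_cut \<pi>)) =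
           (\<Sum>k=1..n. h k * (card (indecomposables C k) * card (C (n - k))))"
proof -
  have "first_cut ` C n \<subseteq> {1..n}"
    using first_cut[OF permutes assms] by (auto simp: Suc_le_eq)
  then have "(\<Sum>\<pi>\<in>C n. h (first_cut \<pi>)) =
      (\<Sum>k=1..n. \<Sum>\<pi>\<in>{\<pi> \<in> C n. first_cut \<pi> = k}. h (first_cut \<pi>))"
    by (rule sum.group[OF finite_C finite_atLeastAtMost, symmetric])
  also have "\<dots> = (\<Sum>k=1..n. h k * (card (indecomposables C k) * card (C (n - k))))"
    by (rule sum.cong[OF refl]) (simp add: card_first_cut mult.commute)
  finally show ?thesis .
qed

lemma card_C:
  assumes "0 < n"
  shows "card (C n) = (\<Sum>k=1..n. card (indecomposables C k) * card (C (n - k)))"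
  using sum_first_cut[OF assms, of "\<lambda>_. 1"] by simp

end

section \<open>Periodic sums\<close>

lemma int_period_cases:
  fixes j :: int
  assumes "0 < n"
  obtains i k where "i \<in> {1..n}" "j = int i + k * int n"
proof -
  define m where "m = (j - 1) mod int n"
  have m: "0 \<le> m" "m < int n" using assms by (simp_all add: m_def)
  have "j = int (nat (m + 1)) + (j - 1) div int n * int n"
    using m(1) div_mult_mod_eq[of "j - 1" "int n"] unfolding m_def[symmetric] by linarith
  moreover have "nat (m + 1) \<in> {1..n}" using m by (simp add: nat_le_iff)
  ultimately show ?thesis using that by blast
qed

lemma cut_shift: "cut_at (shift r s) p \<longleftrightarrow> cut_at s (p - r)"
proof -
  have "cut_at (shift r s) p \<longleftrightarrow> (\<forall>i. s (i - r) \<le> p - r \<longleftrightarrow> i - r \<le> p - r)"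
    by (auto simp: cut_at_def shift_def algebra_simps)
  also have "\<dots> \<longleftrightarrow> cut_at s (p - r)" unfolding cut_at_def by (metis add_diff_cancel_right')
  finally show ?thesis .
qed

lemma shift_shift: "shift q (shift r s) = shift (q + r) s"
  by (auto simp: shift_def algebra_simps)

lemma shift_0: "shift 0 s = s"
  by (simp add: shift_def)

lemma shift_periodic_sum_period:
  assumes "0 < n"
  shows "shift (m * int n) (periodic_sum n \<pi>) = periodic_sum n \<pi>"
proof
  fix j :: int
  obtain i k where ik: "i \<in> {1..n}" "j = int i + k * int n" by (rule int_period_cases[OF assms])
  have "shift (m * int n) (periodic_sum n \<pi>) j
      = periodic_sum n \<pi> (int i + (k - m) * int n) + m * int n"
    by (simp add: shift_def ik(2) algebra_simps)
  also have "\<dots> = periodic_sum n \<pi> j"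
    unfolding ik(2) periodic_sum_eq[OF ik(1)] by (simp add: algebra_simps)
  finally show "shift (m * int n) (periodic_sum n \<pi>) j = periodic_sum n \<pi> j" .
qed

lemma periodic_sum_inject:
  assumes "\<pi> permutes {1..n}" "\<rho> permutes {1..n}" "periodic_sum n \<pi> = periodic_sum n \<rho>"
  shows "\<pi> = \<rho>"
proof
  fix i show "\<pi> i = \<rho> i"
  proof (cases "i \<in> {1..n}")
    case True
    then show ?thesis
      using periodic_sum_eq[OF True, of \<pi> 0] periodic_sum_eq[OF True, of \<rho> 0] assms(3) by simp
  qed (use assms permutes_not_in in metis)
qed

text \<open>The periodic sum maps each translate of \<open>{1..n}\<close> by a multiple of
  \<open>n\<close> to itself. All translates except \<open>{1..n}\<close> lie entirely on one side
  of \<open>a\<close>, so only \<open>\<pi>\<close> itself decides.\<close>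

lemma cut_periodic_sum_iff:
  assumes "\<pi> permutes {1..n}" "0 < n" "a \<le> n"
  shows "cut_at (periodic_sum n \<pi>) (int a) \<longleftrightarrow> cut_at \<pi> a"
proof
  assume *: "cut_at (periodic_sum n \<pi>) (int a)"
  show "cut_at \<pi> a"
    unfolding cut_at_def
  proof
    fix i show "\<pi> i \<le> a \<longleftrightarrow> i \<le> a"
    proof (cases "i \<in> {1..n}")
      case True
      then show ?thesis using periodic_sum_eq[OF True, of \<pi> 0] cut_atD[OF *, of "int i"] by simp
    qed (use permutes_not_in[OF assms(1), of i] in auto)
  qed
next
  assume *: "cut_at \<pi> a"
  show "cut_at (periodic_sum n \<pi>) (int a)"
    unfolding cut_at_def
  proof
    fix j :: int
    obtain i k where ik: "i \<in> {1..n}" "j = int i + k * int n"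
      by (rule int_period_cases[OF assms(2)])
    have pi: "\<pi> i \<in> {1..n}" using permutes_in_image[OF assms(1)] ik(1) by blast
    have "int (\<pi> i) + k * int n \<le> int a \<longleftrightarrow> int i + k * int n \<le> int a"
    proof -
      consider "k = 0" | "k \<le> -1" | "k \<ge> 1" by linarith
      then show ?thesis
      proof cases
        case 1 then show ?thesis using cut_atD[OF *, of i] by simp
      next
        case 2
        then have "k * int n \<le> -1 * int n" by (intro mult_right_mono) auto
        then show ?thesis using pi ik(1) by auto
      next
        case 3
        then have "int n \<le> k * int n" using mult_right_mono[of 1 k "int n"] by simp
        then show ?thesis using pi ik(1) assms(3) unfolding atLeastAtMost_iff by linarith
      qed
    qed
    then show "periodic_sum n \<pi> j \<le> int a \<longleftrightarrow> j \<le> int a"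
      by (simp only: ik(2) periodic_sum_eq[OF ik(1)])
  qed
qed

text \<open>Moving the origin of a periodic sum to a cut of \<open>\<pi>\<close> rotates the period,
  so the two summands change places.\<close>

lemma shift_periodic_sum_cut:
  assumes "\<pi> permutes {1..n}" "0 < n" "a \<le> n" "cut_at \<pi> a"
  shows "shift (- int a) (periodic_sum n \<pi>)
           = periodic_sum n (perm_sum (n - a) (right_part a \<pi>) (left_part a \<pi>))"
proof
  fix j :: int
  obtain i k where ik: "i \<in> {1..n}" "j = int i + k * int n"
    by (rule int_period_cases[OF assms(2)])
  show "shift (- int a) (periodic_sum n \<pi>) j
      = periodic_sum n (perm_sum (n - a) (right_part a \<pi>) (left_part a \<pi>)) j"
  proof (cases "i + a \<le> n")
    case True
    then have i: "i + a \<in> {1..n}" "i \<le> n - a" using ik(1) by auto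
    have "\<pi> (i + a) > a" using cut_atD[OF assms(4), of "i + a"] ik(1) by auto
    then show ?thesis
      using periodic_sum_eq[OF i(1), of \<pi> k] i(2)
      by (simp add: ik(2) periodic_sum_eq[OF ik(1)] shift_def perm_sum_def right_part_def
          add.commute add.left_commute of_nat_diff)
  next
    case False
    then have i: "i + a - n \<in> {1..n}" "\<not> i \<le> n - a" "i + a - n \<le> a" "i - (n - a) = i + a - n"
      using ik(1) assms(3) by auto
    \<comment> \<open>The position has run past the end of its copy of \<open>\<pi>\<close> into the
      next one, hence \<open>k + 1\<close>.\<close>
    have eq: "j + int a = int (i + a - n) + (k + 1) * int n"
      using False by (simp add: ik(2) of_nat_diff algebra_simps)
    show ?thesis
      using periodic_sum_eq[OF i(1), of \<pi> "k + 1"] i(2-4) assms(3) eq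
      by (simp add: ik(2) periodic_sum_eq[OF ik(1)] shift_def perm_sum_def left_part_def
          of_nat_diff algebra_simps)
  qed
qed

section \<open>Counting periodic sums by the block at the origin\<close>

context sum_closed_class
begin

text \<open>Any cut may serve as the origin: reduced modulo the period it becomes a cut
  \<open>a\<close> of \<open>\<pi>\<close>, the period is rotated there, and sum closure puts the
  swapped sum back into \<open>C\<close>.\<close>

lemma shift_to_cut:
  assumes "0 < n" "s \<in> periodic_sums C n" "cut_at s p"
  obtains \<rho> where "\<rho> \<in> C n" "shift (- p) s = periodic_sum n \<rho>"
proof -
  obtain \<pi> r where \<pi>: "\<pi> \<in> C n" "s = shift r (periodic_sum n \<pi>)"
    using assms(2) by (auto simp: periodic_sums_def)
  define a where "a = nat ((p - r) mod int n)"
  define m where "m = (p - r) div int n"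
  have "0 \<le> (p - r) mod int n" "(p - r) mod int n < int n"
    using assms(1) by simp_all
  then have a: "int a = (p - r) mod int n" "a \<le> n"
    unfolding a_def by linarith+
  have pr: "p - r = int a + m * int n" by (simp add: a(1) m_def)
  have "cut_at (periodic_sum n \<pi>) (p - r)"
    using assms(3) by (simp add: \<pi>(2) cut_shift)
  then have "cut_at (shift (- m * int n) (periodic_sum n \<pi>)) (int a)"
    by (simp only: cut_shift) (simp add: pr)
  then have cut: "cut_at \<pi> a"
    unfolding shift_periodic_sum_period[OF assms(1)]
      cut_periodic_sum_iff[OF permutes[OF \<pi>(1)] assms(1) a(2)] .
  have "shift (- p) s = shift (- int a) (shift (- m * int n) (periodic_sum n \<pi>))"
    using pr by (simp add: \<pi>(2) shift_shift algebra_simps)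
  also have "\<dots> = periodic_sum n (perm_sum (n - a) (right_part a \<pi>) (left_part a \<pi>))"
    unfolding shift_periodic_sum_period[OF assms(1)]
    by (rule shift_periodic_sum_cut[OF permutes[OF \<pi>(1)] assms(1) a(2) cut])
  finally show ?thesis
    using that perm_sum_in[OF right_part_in[OF \<pi>(1) cut a(2)] left_part_in[OF \<pi>(1) cut a(2)]] a(2)
    by simp
qed

text \<open>
  The pair \<open>(\<pi>, j)\<close> can be recovered because \<open>- j\<close> is the largest nonpositive cut of its image.
\<close>

lemma bij_betw_periodic_sums:
  assumes "0 < n"
  shows "bij_betw (\<lambda>(\<pi>, j). shift (- int j) (periodic_sum n \<pi>))
           (SIGMA \<pi>:C n. {..<first_cut \<pi>}) (periodic_sums C n)"
  unfolding bij_betw_def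
proof
  have least: "(LEAST i. cut_at (shift (- int j) (periodic_sum n \<pi>)) (- int i)) = j"
    if "\<pi> \<in> C n" "j < first_cut \<pi>" for \<pi> j
  proof (rule Least_equality)
    note perm = permutes[OF that(1)]
    note iff = cut_periodic_sum_iff[OF perm assms]
    have "cut_at \<pi> 0" using permutes_atLeastAtMost_0[OF perm] by (simp add: cut_at_def)
    then show "cut_at (shift (- int j) (periodic_sum n \<pi>)) (- int j)"
      using iff[of 0] by (simp add: cut_shift)
    fix i assume i: "cut_at (shift (- int j) (periodic_sum n \<pi>)) (- int i)"
    show "j \<le> i"
    proof (rule ccontr)
      assume "\<not> j \<le> i"
      \<comment> \<open>A cut at \<open>- i\<close> with \<open>i < j\<close> becomes a cut of
        \<open>\<pi>\<close> at \<open>j - i\<close>, strictly inside its first block.\<close>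
      then have "cut_at (periodic_sum n \<pi>) (int (j - i))" using i by (simp add: cut_shift of_nat_diff)
      moreover have "j - i \<le> n" using that(2) first_cut(3)[OF perm assms] by linarith
      ultimately have "cut_at \<pi> (j - i)" using iff by blast
      then show False using not_cut_below_first_cut[of "j - i" \<pi>] that(2) \<open>\<not> j \<le> i\<close> by auto
    qed
  qed
  show "inj_on (\<lambda>(\<pi>, j). shift (- int j) (periodic_sum n \<pi>)) (SIGMA \<pi>:C n. {..<first_cut \<pi>})"
  proof (rule inj_onI, clarify)
    fix \<pi> j \<rho> i
    assume *: "\<pi> \<in> C n" "j < first_cut \<pi>" "\<rho> \<in> C n" "i < first_cut \<rho>"
      and eq: "shift (- int j) (periodic_sum n \<pi>) = shift (- int i) (periodic_sum n \<rho>)"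
    have ij: "j = i" using least[OF *(1,2)] least[OF *(3,4)] eq by simp
    have "shift (int j) (shift (- int j) (periodic_sum n \<pi>))
        = shift (int j) (shift (- int j) (periodic_sum n \<rho>))"
      using eq ij by simp
    then have "periodic_sum n \<pi> = periodic_sum n \<rho>" by (simp add: shift_shift shift_0)
    then show "\<pi> = \<rho> \<and> j = i" using ij periodic_sum_inject permutes *(1,3) by blast
  qed
  show "(\<lambda>(\<pi>, j). shift (- int j) (periodic_sum n \<pi>)) ` (SIGMA \<pi>:C n. {..<first_cut \<pi>})
          = periodic_sums C n"
  proof
    show "(\<lambda>(\<pi>, j). shift (- int j) (periodic_sum n \<pi>)) ` (SIGMA \<pi>:C n. {..<first_cut \<pi>})
            \<subseteq> periodic_sums C n"
      by (auto simp: periodic_sums_def)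
    show "periodic_sums C n
            \<subseteq> (\<lambda>(\<pi>, j). shift (- int j) (periodic_sum n \<pi>)) ` (SIGMA \<pi>:C n. {..<first_cut \<pi>})"
    proof
      fix s assume s: "s \<in> periodic_sums C n"
      then obtain \<pi> r where \<pi>: "\<pi> \<in> C n" "s = shift r (periodic_sum n \<pi>)"
        by (auto simp: periodic_sums_def)
      define j where "j = (LEAST j. cut_at s (- int j))"
      have "cut_at \<pi> 0" using permutes_atLeastAtMost_0[OF permutes[OF \<pi>(1)]] by (simp add: cut_at_def)
      then have 0: "cut_at (periodic_sum n \<pi>) 0"
        using cut_periodic_sum_iff[OF permutes[OF \<pi>(1)] assms, of 0] by simp
      \<comment> \<open>Some nonpositive cut must exist for the \<open>LEAST\<close> in
        \<open>j\<close>. The starts of the periods of \<open>s\<close>, at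
        \<open>r + m * n\<close>, are cuts, and \<open>- ?i\<close> is one of them.\<close>
      let ?i = "nat ((- r) mod int n)" and ?m = "(- r) div int n"
      have "- int ?i - r = ?m * int n"
        using assms div_mult_mod_eq[of "- r" "int n"] pos_mod_sign[of "int n" "- r"] by linarith
      then have "cut_at (shift (?m * int n) (periodic_sum n \<pi>)) (- int ?i - r)"
        using 0 by (simp add: cut_shift)
      then have "cut_at s (- int ?i)"
        by (simp add: \<pi>(2) cut_shift shift_periodic_sum_period[OF assms])
      then have j: "cut_at s (- int j)" unfolding j_def by (rule LeastI)
      obtain \<rho> where \<rho>: "\<rho> \<in> C n" "shift (int j) s = periodic_sum n \<rho>"
        using shift_to_cut[OF assms s j] by auto
      have s_eq: "s = shift (- int j) (periodic_sum n \<rho>)"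
        by (simp add: \<rho>(2)[symmetric] shift_shift shift_0)
      note fc = first_cut[OF permutes[OF \<rho>(1)] assms]
      have "j < first_cut \<rho>"
      proof (rule ccontr)
        assume nl: "\<not> j < first_cut \<rho>"
        \<comment> \<open>Otherwise the end of the first block of \<open>\<rho>\<close> would be a
          nonpositive cut of \<open>s\<close> nearer to the origin than \<open>- j\<close>.\<close>
        have "cut_at (periodic_sum n \<rho>) (int (first_cut \<rho>))"
          using cut_periodic_sum_iff[OF permutes[OF \<rho>(1)] assms fc(3)] fc(2) by blast
        then have "cut_at s (- int (j - first_cut \<rho>))"
          using nl by (simp add: s_eq cut_shift of_nat_diff)
        then have "j \<le> j - first_cut \<rho>" unfolding j_def by (rule Least_le)
        then show False using fc(1) nl by linarith
      qed
      then show "s \<in> (\<lambda>(\<pi>, j). shift (- int j) (periodic_sum n \<pi>)) ` (SIGMA \<pi>:C n. {..<first_cut \<pi>})"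
        using \<rho>(1) s_eq by (auto intro!: image_eqI[of _ _ "(\<rho>, j)"])
    qed
  qed
qed

text \<open>Each \<open>\<pi>\<close> is counted \<open>first_cut \<pi>\<close> times, once per
  place of the origin in its first block. This is \<open>P = x G' F\<close> coefficientwise.\<close>

lemma card_periodic_sums:
  assumes "0 < n"
  shows "card (periodic_sums C n)
           = (\<Sum>k=1..n. k * (card (indecomposables C k) * card (C (n - k))))"
  using bij_betw_same_card[OF bij_betw_periodic_sums[OF assms]] sum_first_cut[OF assms, of id]
  by (simp add: card_SigmaI finite_C)

end

section \<open>Convolutions and renewal sequences\<close>

text \<open>Tannery's theorem: with the terms extended by \<open>0\<close> beyond \<open>n\<close>,
  each converges to \<open>q k * P\<close> and is dominated by a multiple of
  \<open>\<bar>q k\<bar>\<close>.\<close>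

lemma convolution_tendsto:
  fixes p q :: "nat \<Rightarrow> real"
  assumes "p \<longlonglongrightarrow> P" "summable (\<lambda>n. \<bar>q n\<bar>)"
  shows "(\<lambda>n. \<Sum>i\<le>n. q i * p (n - i)) \<longlonglongrightarrow> suminf q * P"
proof -
  define f where "f k n = (if k \<le> n then q k * p (n - k) else 0)" for k n
  obtain B where B: "\<bar>p n\<bar> \<le> B" for n
    using convergent_imp_Bseq[OF convergentI[OF assms(1)]] unfolding Bseq_def by auto
  have "(\<lambda>n. suminf (\<lambda>k. f k n)) \<longlonglongrightarrow> suminf (\<lambda>k. q k * P)"
  proof (rule tannerys_theorem[THEN conjunct2, THEN conjunct2])
    fix k
    have "(\<lambda>n. q k * p n) \<longlonglongrightarrow> q k * P"
      by (intro tendsto_intros assms)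
    then have "(\<lambda>n. f k (n + k)) \<longlonglongrightarrow> q k * P"
      by (simp add: f_def)
    then show "f k \<longlonglongrightarrow> q k * P" by (rule LIMSEQ_offset)
  next
    have "norm (f k n) \<le> \<bar>q k\<bar> * B" for k n
      using B[of "n - k"] order_trans[OF abs_ge_zero B]
      by (auto simp: f_def abs_mult intro!: mult_left_mono)
    then show "\<forall>\<^sub>F (k, n) in sequentially \<times>\<^sub>F sequentially. norm (f k n) \<le> \<bar>q k\<bar> * B"
      by (auto intro!: always_eventually)
    show "summable (\<lambda>k. \<bar>q k\<bar> * B)" by (intro summable_mult2 assms)
  qed simp
  moreover have "suminf (\<lambda>k. f k n) = (\<Sum>i\<le>n. q i * p (n - i))" for n
    by (subst suminf_finite[of "{..n}"]) (auto simp: f_def)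
  moreover have "suminf (\<lambda>k. q k * P) = suminf q * P"
    using suminf_mult2[OF summable_rabs_cancel[OF assms(2)]] by simp
  ultimately show ?thesis by simp
qed

text \<open>By the mean value theorem. It is the induction step for bounding the sum of
  \<open>(k + 1) powr - l\<close> by its integral.\<close>

lemma powr_diff_ge:
  fixes x l :: real
  assumes "0 < x" "0 < l" "l < 1"
  shows "(1 - l) * (x + 1) powr - l \<le> (x + 1) powr (1 - l) - x powr (1 - l)"
proof -
  have "((\<lambda>z. z powr (1 - l)) has_real_derivative (1 - l) * z powr - l) (at z)"
    if "x \<le> z" for z
    using that assms by (auto intro!: derivative_eq_intros simp: algebra_simps)
  then obtain z where z: "x < z" "z < x + 1"
      "(x + 1) powr (1 - l) - x powr (1 - l) = (x + 1 - x) * ((1 - l) * z powr - l)"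
    using MVT2[of x "x + 1" "\<lambda>z. z powr (1 - l)" "\<lambda>z. (1 - l) * z powr - l"] by auto
  have "(x + 1) powr - l \<le> z powr - l"
    by (rule powr_mono2') (use z assms in auto)
  then show ?thesis using z(3) assms by simp
qed

lemma sum_powr_le:
  fixes l :: real
  assumes "0 < l" "l < 1"
  shows "(\<Sum>k\<le>n. (real k + 1) powr - l) \<le> (real n + 1) powr (1 - l) / (1 - l)"
proof (induction n)
  case 0
  then show ?case using assms by (simp add: field_simps)
next
  case (Suc n)
  then show ?case
    using powr_diff_ge[of "real n + 1" l] assms by (simp add: field_simps)
qed

text \<open>Since \<open>2 powr l \<le> 2\<close>, arguments comparable up to a factor
  \<open>2\<close> may be exchanged at the cost of a factor \<open>2\<close>.\<close>

lemma powr_le_double: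
  fixes x y l :: real
  assumes "0 \<le> x" "x \<le> 2 * y" "0 \<le> l" "l \<le> 1"
  shows "x powr l \<le> 2 * y powr l"
proof -
  have "x powr l \<le> (2 * y) powr l" by (rule powr_mono2) (use assms in auto)
  also have "\<dots> = 2 powr l * y powr l" using assms by (simp add: powr_mult)
  also have "\<dots> \<le> 2 powr 1 * y powr l" by (intro mult_right_mono powr_mono) (use assms in auto)
  finally show ?thesis by simp
qed

text \<open>The shift to \<open>n + 1\<close> covers \<open>n = 0\<close>, where
  \<open>0 powr l = 0\<close> carries no information; \<open>\<bar>p 0\<bar>\<close> is added to the
  constant for that case.\<close>

lemma bounded_by_shifted_powr:
  fixes p :: "nat \<Rightarrow> real"
  assumes "(\<lambda>n. p n * real n powr l) \<longlonglongrightarrow> K" "0 < l" "l < 1"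
  obtains B where "0 < B" "\<And>n. \<bar>p n\<bar> \<le> B * (real n + 1) powr - l"
proof -
  obtain B0 where B0: "0 < B0" "\<bar>p n * real n powr l\<bar> \<le> B0" for n
    using convergent_imp_Bseq[OF convergentI[OF assms(1)]] unfolding Bseq_def by auto
  have "\<bar>p n\<bar> * (real n + 1) powr l \<le> 2 * B0 + \<bar>p 0\<bar>" for n
  proof (cases "n = 0")
    case False
    then have "(real n + 1) powr l \<le> 2 * real n powr l"
      by (intro powr_le_double) (use assms in auto)
    then have "\<bar>p n\<bar> * (real n + 1) powr l \<le> \<bar>p n\<bar> * (2 * real n powr l)"
      by (rule mult_left_mono) simp
    also have "\<dots> \<le> 2 * B0" using B0(2)[of n] by (simp add: abs_mult)
    finally show ?thesis by linarith
  qed (use B0(1) in simp)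
  then have "\<bar>p n\<bar> \<le> (2 * B0 + \<bar>p 0\<bar>) * (real n + 1) powr - l" for n
    by (simp add: powr_minus field_simps)
  then show ?thesis using that[of "2 * B0 + \<bar>p 0\<bar>"] B0(1) by auto
qed

text \<open>
  The terms with \<open>i \<le> n / 2\<close> are handled by Tannery's theorem; in the others \<open>q i = o(1 / n)\<close>, while the
  values of \<open>p\<close> sum to \<open>O(n powr (1 - l))\<close>.
\<close>

lemma convolution_powr_tendsto:
  fixes p q :: "nat \<Rightarrow> real" and l :: real
  assumes p: "(\<lambda>n. p n * real n powr l) \<longlonglongrightarrow> K"
    and l: "0 < l" "l < 1"
    and q: "\<And>n. 0 \<le> q n" "summable q" "(\<lambda>n. real n * q n) \<longlonglongrightarrow> 0"
  shows "(\<lambda>n. (\<Sum>i\<le>n. q i * p (n - i)) * real n powr l) \<longlonglongrightarrow> suminf q * K"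
proof -
  obtain B where B: "0 < B" "\<And>n. \<bar>p n\<bar> \<le> B * (real n + 1) powr - l"
    using bounded_by_shifted_powr[OF p l] by blast
  define f where "f k n = (if 2 * k \<le> n then q k * p (n - k) * real n powr l else 0)" for k n
  define R where "R n = (\<Sum>i | i \<le> n \<and> n < 2 * i. q i * p (n - i)) * real n powr l" for n
  have "(\<lambda>n. suminf (\<lambda>k. f k n)) \<longlonglongrightarrow> suminf (\<lambda>k. q k * K)"
  proof (rule tannerys_theorem[THEN conjunct2, THEN conjunct2])
    fix k
    have "(\<lambda>m. (real m + real k) powr l / real m powr l) \<longlonglongrightarrow> 1"
      by real_asymp
    from tendsto_mult[OF tendsto_mult[OF tendsto_const[of "q k"] p] this]
    have "(\<lambda>m. q k * (p m * real m powr l) * ((real m + real k) powr l / real m powr l))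
        \<longlonglongrightarrow> q k * K" by simp
    moreover have "\<forall>\<^sub>F m in sequentially.
        q k * (p m * real m powr l) * ((real m + real k) powr l / real m powr l) = f k (m + k)"
      using eventually_ge_at_top[of "k + 1"] by eventually_elim (auto simp: f_def)
    ultimately have "(\<lambda>m. f k (m + k)) \<longlonglongrightarrow> q k * K"
      by (rule Lim_transform_eventually)
    then show "f k \<longlonglongrightarrow> q k * K" by (rule LIMSEQ_offset)
  next
    have "norm (f k n) \<le> q k * (2 * B)" for k n
    proof (cases "2 * k \<le> n")
      case True
      have "real n powr l \<le> 2 * (real (n - k) + 1) powr l"
        by (rule powr_le_double) (use True l in auto)
      then have "\<bar>p (n - k)\<bar> * real n powr l
          \<le> (B * (real (n - k) + 1) powr - l) * (2 * (real (n - k) + 1) powr l)"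
        using B by (intro mult_mono) auto
      also have "\<dots> = 2 * B" by (simp add: powr_minus)
      finally show ?thesis using True q(1)[of k]
        by (simp add: f_def abs_mult mult.assoc mult_left_mono)
    qed (use q(1) B(1) in \<open>simp add: f_def\<close>)
    then show "\<forall>\<^sub>F (k, n) in sequentially \<times>\<^sub>F sequentially. norm (f k n) \<le> q k * (2 * B)"
      by (auto intro!: always_eventually)
    show "summable (\<lambda>k. q k * (2 * B))" by (intro summable_mult2 q)
  qed simp
  moreover have "suminf (\<lambda>k. q k * K) = suminf q * K"
    using suminf_mult2[OF q(2)] by simp
  moreover have "suminf (\<lambda>k. f k n) = (\<Sum>i | 2 * i \<le> n. q i * p (n - i)) * real n powr l" for n
  proof -
    have fin: "finite {i. 2 * i \<le> n}" by (rule finite_subset[of _ "{..n}"]) auto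
    show ?thesis
      by (subst suminf_finite[OF fin]) (auto simp: f_def sum_distrib_right)
  qed
  moreover have "R \<longlonglongrightarrow> 0"
  proof (rule LIMSEQ_I)
    fix e :: real assume e: "0 < e"
    \<comment> \<open>Chosen so that the final bound \<open>4 * d * B / (1 - l)\<close> equals
      \<open>e / 2\<close>.\<close>
    define d where "d = e * (1 - l) / (8 * B)"
    have d: "0 < d" using e l B(1) by (simp add: d_def)
    obtain N where N: "\<And>n. n \<ge> N \<Longrightarrow> real n * q n < d"
      using LIMSEQ_D[OF q(3) d] q(1) by (auto simp: abs_mult)
    \<comment> \<open>The bound \<open>2 * N + 1\<close> ensures that every \<open>i\<close> with
      \<open>n < 2 * i\<close> is at least \<open>N\<close>.\<close>
    have "norm (R n - 0) < e" if n: "n \<ge> 2 * N + 1" for n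
    proof -
      have npos: "0 < real n" using n by simp
      have "\<bar>\<Sum>i | i \<le> n \<and> n < 2 * i. q i * p (n - i)\<bar>
          \<le> (\<Sum>i | i \<le> n \<and> n < 2 * i. (2 * d / real n) * (B * (real (n - i) + 1) powr - l))"
      proof (rule order_trans[OF sum_abs sum_mono])
        fix i assume i: "i \<in> {i. i \<le> n \<and> n < 2 * i}"
        then have "real n * q i \<le> 2 * (real i * q i)"
          using mult_right_mono[of "real n" "2 * real i" "q i"] q(1) by simp
        also have "\<dots> \<le> 2 * d" using N[of i] i n by simp
        finally have "q i \<le> 2 * d / real n" using npos by (simp add: field_simps)
        then show "\<bar>q i * p (n - i)\<bar> \<le> (2 * d / real n) * (B * (real (n - i) + 1) powr - l)"
          unfolding abs_mult using B q(1)[of i] d npos by (intro mult_mono) auto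
      qed
      also have "\<dots> \<le> (\<Sum>i\<le>n. (2 * d / real n) * (B * (real (n - i) + 1) powr - l))"
        by (rule sum_mono2) (use B d in auto)
      also have "\<dots> = (2 * d / real n * B) * (\<Sum>i\<le>n. (real (n - i) + 1) powr - l)"
        by (simp add: sum_distrib_left mult.assoc)
      also have "(\<Sum>i\<le>n. (real (n - i) + 1) powr - l) = (\<Sum>i\<le>n. (real i + 1) powr - l)"
        using sum.nat_diff_reindex[of "\<lambda>i. (real i + 1) powr - l" "Suc n"]
        unfolding lessThan_Suc_atMost by simp
      also have "(2 * d / real n * B) * \<dots> \<le> (2 * d / real n * B) * (2 * real n powr (1 - l) / (1 - l))"
      proof (rule mult_left_mono)
        have "(real n + 1) powr (1 - l) \<le> 2 * real n powr (1 - l)"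
          by (rule powr_le_double) (use n l in auto)
        then show "(\<Sum>i\<le>n. (real i + 1) powr - l) \<le> 2 * real n powr (1 - l) / (1 - l)"
          using order_trans[OF sum_powr_le[OF l]] l by (simp add: divide_right_mono)
      qed (use d B in auto)
      finally have "\<bar>R n\<bar> \<le> (2 * d / real n * B) * (2 * real n powr (1 - l) / (1 - l)) * real n powr l"
        unfolding R_def abs_mult abs_of_nonneg[OF powr_ge_zero] by (rule mult_right_mono) simp
      also have "\<dots> = 4 * d * B / (1 - l) * (real n powr (1 - l) * real n powr l / real n)"
        by (simp add: mult_ac)
      also have "real n powr (1 - l) * real n powr l = real n"
        using npos by (simp add: powr_add[symmetric])
      also have "4 * d * B / (1 - l) * (real n / real n) = e / 2"
        using npos B(1) l by (simp add: d_def divide_eq_eq)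
      finally show ?thesis using e by simp
    qed
    then show "\<exists>no. \<forall>n\<ge>no. norm (R n - 0) < e" by blast
  qed
  ultimately have "(\<lambda>n. (\<Sum>i | 2 * i \<le> n. q i * p (n - i)) * real n powr l + R n)
      \<longlonglongrightarrow> suminf q * K"
    using tendsto_add by fastforce
  moreover have "(\<Sum>i | 2 * i \<le> n. q i * p (n - i)) * real n powr l + R n
      = (\<Sum>i\<le>n. q i * p (n - i)) * real n powr l" for n
  proof -
    have "{..n} = {i. 2 * i \<le> n} \<union> {i. i \<le> n \<and> n < 2 * i}" by auto
    moreover have "finite {i. 2 * i \<le> n}" by (rule finite_subset[of _ "{..n}"]) auto
    ultimately show ?thesis
      unfolding R_def distrib_right[symmetric]
      by (simp only:) (subst sum.union_disjoint, auto)
  qed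
  ultimately show ?thesis by simp
qed

section \<open>The renewal equation\<close>

lemma fps_X_mult_deriv_nth: "(fps_X * fps_deriv f) $ n = of_nat n * f $ n"
  by (cases n) auto

lemma convolution_nonneg_summable:
  fixes p q :: "nat \<Rightarrow> real"
  assumes "\<And>n. 0 \<le> p n" "\<And>n. 0 \<le> q n" "summable p" "summable q"
  shows "(\<lambda>n. \<Sum>i\<le>n. p i * q (n - i)) sums (suminf p * suminf q)"
  using Cauchy_product_sums[of p q] assms by simp

text \<open>\<open>convolution_powr_tendsto\<close> requires the terms of the summable factor to be
  \<open>o(1 / n)\<close>, which is obtained by bootstrapping: \<open>p\<close> tends to
  \<open>0\<close>, so \<open>n * \<phi> n\<close> does by the weaker
  \<open>convolution_tendsto\<close>, so \<open>n * \<phi>2 n\<close> does by the same lemma, and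
  only then are the sharp limits taken.\<close>

lemma renewal_asymptotics:
  fixes a \<phi> :: "nat \<Rightarrow> real" and l K t :: real
  assumes a: "\<And>n. 0 \<le> a n" "a 0 = 0" "a sums t" "t < 1"
    and l: "0 < l" "l < 1"
    and lim: "(\<lambda>n. a n * real n powr (1 + l)) \<longlonglongrightarrow> K"
    and \<phi>: "\<phi> 0 = 1" "\<And>n. 0 < n \<Longrightarrow> \<phi> n = (\<Sum>i\<le>n. a i * \<phi> (n - i))"
  shows "(\<lambda>n. \<phi> n * real n powr (1 + l)) \<longlonglongrightarrow> K / (1 - t)\<^sup>2" (is ?thesis1)
    and "(\<lambda>n. (\<Sum>i\<le>n. real i * a i * \<phi> (n - i)) * real n powr l) \<longlonglongrightarrow> K / (1 - t)" (is ?thesis2)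
proof -
  define p where "p n = real n * a n" for n
  define \<phi>2 where "\<phi>2 n = (\<Sum>i\<le>n. \<phi> i * \<phi> (n - i))" for n
  define A where "A = Abs_fps a"
  define F where "F = Abs_fps \<phi>"
  have \<phi>_eq: "\<phi> n = (if n = 0 then 1 else 0) + (\<Sum>i\<le>n. a i * \<phi> (n - i))" for n
    using \<phi>(1) \<phi>(2)[of n] a(2) by (cases "n = 0") simp_all
  have F: "F * (1 - A) = 1"
  proof -
    have "F = 1 + A * F"
    proof (rule fps_ext)
      fix n show "F $ n = (1 + A * F) $ n"
        using \<phi>_eq[of n] by (simp add: F_def A_def fps_mult_nth atLeast0AtMost)
    qed
    then show ?thesis by (simp add: algebra_simps)
  qed
  have "fps_deriv F * (1 - A) - F * fps_deriv A = 0"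
    using arg_cong[OF F, of fps_deriv] by (simp add: algebra_simps)
  \<comment> \<open>Multiplying by \<open>F\<close> lets \<open>F * (1 - A) = 1\<close> eliminate
    \<open>1 - A\<close>, leaving \<open>F' = F\<^sup>2 A'\<close>.\<close>
  then have "F * (fps_deriv F * (1 - A) - F * fps_deriv A) = 0" by simp
  then have "fps_deriv F * (F * (1 - A)) = F * F * fps_deriv A" by (simp add: algebra_simps)
  then have "fps_deriv F = F * F * fps_deriv A" by (simp add: F)
  define DF where "DF = fps_X * fps_deriv F"
  define DA where "DA = fps_X * fps_deriv A"
  have nth: "DF $ n = real n * \<phi> n" "DA $ n = p n" for n
    unfolding DF_def DA_def fps_X_mult_deriv_nth by (simp_all add: F_def A_def p_def)
  have DF: "DF = (F * F) * DA"
    unfolding DF_def DA_def \<open>fps_deriv F = F * F * fps_deriv A\<close> by (simp add: mult_ac)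
  have \<phi>2: "F * F = Abs_fps \<phi>2"
    by (intro fps_ext) (simp add: F_def \<phi>2_def fps_mult_nth atLeast0AtMost)
  have n\<phi>: "real n * \<phi> n = (\<Sum>i\<le>n. \<phi>2 i * p (n - i))" for n
    using arg_cong[OF DF, of "\<lambda>f. f $ n"]
    unfolding nth \<phi>2 by (simp add: fps_mult_nth nth atLeast0AtMost)
  have "fps_X * fps_deriv (F * F) = F * DF + F * DF"
    by (simp add: DF_def algebra_simps)
  then have "(fps_X * fps_deriv (F * F)) $ n = (F * DF + F * DF) $ n" for n
    by (rule arg_cong)
  then have n\<phi>2: "real n * \<phi>2 n = 2 * (\<Sum>i\<le>n. \<phi> i * (real (n - i) * \<phi> (n - i)))" for n
    unfolding fps_X_mult_deriv_nth \<phi>2 fps_add_nth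
    by (simp add: fps_mult_nth nth atLeast0AtMost F_def)
  have \<phi>_nonneg: "0 \<le> \<phi> n" for n
  proof (induction n rule: less_induct)
    case (less n)
    have "0 \<le> a i * \<phi> (n - i)" if "i \<le> n" for i
      \<comment> \<open>The term \<open>i = 0\<close>, the only one that involves
        \<open>\<phi> n\<close> itself, vanishes because \<open>a 0 = 0\<close>.\<close>
      using less[of "n - i"] a(1)[of i] a(2) that by (cases "i = 0"; cases "n = 0") auto
    then show ?case by (subst \<phi>_eq) (auto intro!: sum_nonneg add_nonneg_nonneg)
  qed
  have t: "suminf a = t" "summable a" using a(3) by (auto simp: sums_iff)
  \<comment> \<open>The partial sums \<open>S\<close> satisfy \<open>S \<le> 1 + t * S\<close>: the
    triangle of index pairs is enlarged to a square, whose sum factorises. Here \<open>t < 1\<close>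
    is essential.\<close>
  have bound: "(\<Sum>n<N. \<phi> n) \<le> 1 / (1 - t)" for N
  proof -
    have "(\<Sum>n<N. \<phi> n) = (\<Sum>n<N. if n = 0 then 1 else 0) + (\<Sum>n<N. \<Sum>i\<le>n. a i * \<phi> (n - i))"
      unfolding sum.distrib[symmetric] by (intro sum.cong refl \<phi>_eq)
    also have "(\<Sum>n<N. \<Sum>i\<le>n. a i * \<phi> (n - i)) = (\<Sum>(i, j)\<in>{(i, j). i + j < N}. a i * \<phi> j)"
      by (rule sum.triangle_reindex[symmetric])
    also have "\<dots> \<le> (\<Sum>(i, j)\<in>{..<N} \<times> {..<N}. a i * \<phi> j)"
      by (rule sum_mono2) (use a(1) \<phi>_nonneg in auto)
    also have "\<dots> = (\<Sum>i<N. a i) * (\<Sum>j<N. \<phi> j)"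
      by (simp add: sum_product sum.cartesian_product)
    also have "\<dots> \<le> t * (\<Sum>j<N. \<phi> j)"
      using sum_le_suminf[OF t(2), of "{..<N}"] a(1) t(1) \<phi>_nonneg
      by (intro mult_right_mono sum_nonneg) auto
    also have "(\<Sum>n<N. if n = 0 then 1 else 0) \<le> (1::real)" by (simp add: sum.delta)
    finally show ?thesis using a(4) by (simp add: field_simps)
  qed
  have sum_\<phi>: "summable \<phi>" by (rule summableI_nonneg_bounded[OF \<phi>_nonneg bound])
  have "(\<lambda>n. (if n = 0 then 1 else 0) + (\<Sum>i\<le>n. a i * \<phi> (n - i))) sums (1 + t * suminf \<phi>)"
    using sums_add[OF sums_single[of 0 "\<lambda>_. 1::real"]
        convolution_nonneg_summable[OF a(1) \<phi>_nonneg t(2) sum_\<phi>]] t(1)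
    by (simp add: eq_commute[of 0])
  then have "\<phi> sums (1 + t * suminf \<phi>)" unfolding \<phi>_eq[symmetric] .
  then have "suminf \<phi> = 1 + t * suminf \<phi>" by (rule sums_unique[symmetric])
  then have suminf_\<phi>: "suminf \<phi> = 1 / (1 - t)" using a(4) by (simp add: field_simps)
  have "\<phi>2 sums (suminf \<phi> * suminf \<phi>)"
    unfolding \<phi>2_def by (rule convolution_nonneg_summable[OF \<phi>_nonneg \<phi>_nonneg sum_\<phi> sum_\<phi>])
  then have sum_\<phi>2: "summable \<phi>2" "suminf \<phi>2 = 1 / (1 - t)\<^sup>2"
    using suminf_\<phi> by (auto simp: sums_iff power2_eq_square)
  have \<phi>2_nonneg: "0 \<le> \<phi>2 n" for n
    unfolding \<phi>2_def using \<phi>_nonneg by (auto intro!: sum_nonneg)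
  have powr_Suc: "real n powr (1 + l) = real n * real n powr l" for n
    by (simp add: powr_add powr_one_gt_zero_iff)
  have p_lim: "(\<lambda>n. p n * real n powr l) \<longlonglongrightarrow> K"
    using lim by (simp add: p_def powr_Suc mult_ac)
  have "(\<lambda>n. real n powr - l) \<longlonglongrightarrow> 0" using l by real_asymp
  from tendsto_mult[OF p_lim this] have "(\<lambda>n. p n * real n powr l * real n powr - l) \<longlonglongrightarrow> 0"
    by simp
  moreover have "\<forall>\<^sub>F n in sequentially. p n * real n powr l * real n powr - l = p n"
    using eventually_gt_at_top[of 0] by eventually_elim (simp add: powr_minus)
  ultimately have p_0: "p \<longlonglongrightarrow> 0" by (rule Lim_transform_eventually)
  have n\<phi>_0: "(\<lambda>n. real n * \<phi> n) \<longlonglongrightarrow> 0"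
    using convolution_tendsto[OF p_0, of \<phi>2] sum_\<phi>2 \<phi>2_nonneg by (simp add: n\<phi>)
  have n\<phi>2_0: "(\<lambda>n. real n * \<phi>2 n) \<longlonglongrightarrow> 0"
    using tendsto_mult[OF tendsto_const[of 2] convolution_tendsto[OF n\<phi>_0, of \<phi>]] sum_\<phi> \<phi>_nonneg
    by (simp add: n\<phi>2)
  have "(\<lambda>n. real n * \<phi> n * real n powr l) \<longlonglongrightarrow> K / (1 - t)\<^sup>2"
    using convolution_powr_tendsto[OF p_lim l \<phi>2_nonneg sum_\<phi>2(1) n\<phi>2_0]
    by (simp add: n\<phi> sum_\<phi>2(2))
  then show ?thesis1 by (simp add: powr_Suc mult_ac)
  \<comment> \<open>Reversed, so that \<open>\<phi>\<close> becomes the summable factor and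
    \<open>p\<close> the regularly varying one.\<close>
  have "(\<Sum>i\<le>n. real i * a i * \<phi> (n - i)) = (\<Sum>i\<le>n. \<phi> i * p (n - i))" for n
    by (rule sum.reindex_bij_witness[of _ "\<lambda>i. n - i" "\<lambda>i. n - i"]) (auto simp: p_def)
  then show ?thesis2
    using convolution_powr_tendsto[OF p_lim l \<phi>_nonneg sum_\<phi> n\<phi>_0] by (simp add: suminf_\<phi>)
qed

section \<open>Coefficients at an algebraic singularity\<close>

text \<open>
  On the circle \<open>|1 - z|\<^sup>2 = (1 - z) (z - \<rho>\<^sup>2) / z\<close>, so this is an instance of Cauchy's integral formula.
\<close>

lemma inverse_square_dist_circle_integral:
  assumes "0 < \<rho>" "\<rho> < 1"
  shows "((\<lambda>t. 1 / (cmod (1 - circlepath 0 \<rho> t))\<^sup>2) has_integral 1 / (1 - \<rho>\<^sup>2)) {0..1}"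
proof -
  \<comment> \<open>The pole \<open>\<rho>\<^sup>2\<close> lies inside the circle of radius
    \<open>\<rho>\<close>, the pole \<open>1\<close> outside.\<close>
  have sq: "\<rho>\<^sup>2 < \<rho>" using assms by (simp add: power2_eq_square)
  have "((\<lambda>u. 1 / (1 - u) / (u - of_real (\<rho>\<^sup>2))) has_contour_integral
      (2 * of_real pi * \<i> * (1 / (1 - of_real (\<rho>\<^sup>2))))) (circlepath 0 \<rho>)"
  proof (rule Cauchy_integral_circlepath_simple)
    show "(\<lambda>u. 1 / (1 - u)) holomorphic_on cball 0 \<rho>"
      using assms by (auto intro!: holomorphic_intros)
    show "cmod (complex_of_real (\<rho>\<^sup>2) - 0) < \<rho>"
      unfolding diff_zero norm_of_real using sq assms by simp
  qed
  then have *: "((\<lambda>t. 1 / (1 - circlepath 0 \<rho> t) / (circlepath 0 \<rho> t - of_real (\<rho>\<^sup>2)) *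
        vector_derivative (circlepath 0 \<rho>) (at t))
      has_integral (2 * of_real pi * \<i> * (1 / (1 - of_real (\<rho>\<^sup>2))))) {0..1}"
    by (simp only: has_contour_integral)
  have eq: "1 / (1 - circlepath 0 \<rho> t) / (circlepath 0 \<rho> t - of_real (\<rho>\<^sup>2)) *
        vector_derivative (circlepath 0 \<rho>) (at t)
      = 2 * of_real pi * \<i> * of_real (1 / (cmod (1 - circlepath 0 \<rho> t))\<^sup>2)" for t
  proof -
    define z where "z = circlepath 0 \<rho> t"
    have norm_z: "cmod z = \<rho>" using assms by (simp add: z_def circlepath norm_mult)
    have deriv: "vector_derivative (circlepath 0 \<rho>) (at t) = 2 * of_real pi * \<i> * z"
      by (simp add: vector_derivative_circlepath z_def) (simp add: circlepath)
    have z: "z \<noteq> 0" "z \<noteq> 1" "cnj z \<noteq> 1" using norm_z assms by auto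
    have "of_real (\<rho>\<^sup>2) = z * cnj z" using norm_z complex_norm_square[of z] by simp
    then have 1: "z - of_real (\<rho>\<^sup>2) = z * (1 - cnj z)" by (simp add: algebra_simps)
    have "of_real ((cmod (1 - z))\<^sup>2) = (1 - z) * (1 - cnj z)"
      using complex_norm_square[of "1 - z"] by simp
    then have 2: "complex_of_real (1 / (cmod (1 - z))\<^sup>2) = 1 / ((1 - z) * (1 - cnj z))"
      unfolding of_real_divide by simp
    show ?thesis
      unfolding z_def[symmetric] deriv 1 2 using z by simp
  qed
  have "((\<lambda>t. of_real (1 / (cmod (1 - circlepath 0 \<rho> t))\<^sup>2))
      has_integral complex_of_real (1 / (1 - \<rho>\<^sup>2))) {0..1}"
    using has_integral_mult_right[OF *[unfolded eq], of "1 / (2 * of_real pi * \<i>)"] by simp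
  from has_integral_linear[OF this bounded_linear_Re] show ?thesis
    by (simp add: o_def)
qed

text \<open>Cauchy's formula with the bound integrated instead of maximised: the mean
  \<open>1 / (1 - \<rho>\<^sup>2)\<close> of \<open>1 / |1 - z|\<^sup>2\<close> is smaller by one
  order in \<open>1 - \<rho>\<close> than its maximum.\<close>

lemma coefficient_bound_circle:
  assumes hol: "g holomorphic_on ball 0 1" and \<rho>: "0 < \<rho>" "\<rho> < 1"
    and bound: "\<And>z. cmod z = \<rho> \<Longrightarrow> cmod (g z) \<le> \<alpha> / (cmod (1 - z))\<^sup>2 + M"
  shows "cmod ((deriv ^^ n) g 0 / fact n) \<le> (\<alpha> / (1 - \<rho>\<^sup>2) + M) / \<rho> ^ n"
proof -
  define h where "h t = g (circlepath 0 \<rho> t) / (circlepath 0 \<rho> t - 0) ^ Suc n *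
      vector_derivative (circlepath 0 \<rho>) (at t)" for t
  have sub: "cball 0 \<rho> \<subseteq> ball (0::complex) 1" using \<rho> by auto
  have "g holomorphic_on cball 0 \<rho>" using hol sub by (rule holomorphic_on_subset)
  then have cont: "continuous_on (cball 0 \<rho>) g" and hol': "g holomorphic_on ball 0 \<rho>"
    by (auto intro: holomorphic_on_imp_continuous_on holomorphic_on_subset)
  have 0: "0 \<in> ball 0 \<rho>" using \<rho> by simp
  note C = Cauchy_higher_derivative_integral_circlepath[OF cont hol' 0, of n]
  have int_h: "h integrable_on {0..1}" and eq: "(deriv ^^ n) g 0 = fact n / (2 * pi * \<i>) * integral {0..1} h"
    using C unfolding h_def contour_integral_integral contour_integrable_on by blast+
  have int_k: "((\<lambda>t. (2 * pi / \<rho> ^ n) * (\<alpha> * (1 / (cmod (1 - circlepath 0 \<rho> t))\<^sup>2) + M)) has_integral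
      (2 * pi / \<rho> ^ n) * (\<alpha> * (1 / (1 - \<rho>\<^sup>2)) + M * (1 - 0))) {0..1}"
    by (intro has_integral_mult_right has_integral_add inverse_square_dist_circle_integral \<rho>)
       (use has_integral_const_real[of M 0 1] in simp)
  have "cmod (integral {0..1} h) \<le>
      integral {0..1} (\<lambda>t. (2 * pi / \<rho> ^ n) * (\<alpha> * (1 / (cmod (1 - circlepath 0 \<rho> t))\<^sup>2) + M))"
  proof (rule integral_norm_bound_integral[OF int_h])
    fix t :: real
    have norm: "cmod (circlepath 0 \<rho> t) = \<rho>" using \<rho> by (simp add: circlepath norm_mult)
    have "cmod (h t) = (2 * pi / \<rho> ^ n) * cmod (g (circlepath 0 \<rho> t))"
      using \<rho> by (simp add: h_def norm_mult norm_divide norm_power norm vector_derivative_circlepath)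
    also have "\<dots> \<le> (2 * pi / \<rho> ^ n) * (\<alpha> * (1 / (cmod (1 - circlepath 0 \<rho> t))\<^sup>2) + M)"
      using bound[OF norm] \<rho> by (intro mult_left_mono) auto
    finally show "cmod (h t) \<le> \<dots>" .
  qed (use int_k in blast)
  also have "\<dots> = (2 * pi / \<rho> ^ n) * (\<alpha> * (1 / (1 - \<rho>\<^sup>2)) + M * (1 - 0))"
    using int_k by (rule integral_unique)
  finally have "cmod (integral {0..1} h) \<le> 2 * pi * ((\<alpha> / (1 - \<rho>\<^sup>2) + M) / \<rho> ^ n)"
    by simp
  then show ?thesis
    unfolding eq by (simp add: norm_mult norm_divide field_simps)
qed

text \<open>
  The third derivative is the right one: on the circle of radius \<open>1 - 1 / n\<close> the factor
  \<open>|1 - z| powr (l - 3)\<close> is at most \<open>n powr (1 - l)\<close> times \<open>1 / |1 - z|\<^sup>2\<close>, whose mean is explicit.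
\<close>

lemma coefficients_little_o:
  fixes l :: real
  assumes hol: "f holomorphic_on ball 0 1" and l: "0 < l" "l < 1"
    and bound: "\<And>\<eta>. 0 < \<eta> \<Longrightarrow> \<exists>M. \<forall>z\<in>ball 0 1.
      cmod ((deriv ^^ 3) f z) \<le> \<eta> * cmod (1 - z) powr (l - 3) + M"
  shows "(\<lambda>n. (deriv ^^ n) f 0 / fact n * of_real (real n powr (1 + l))) \<longlonglongrightarrow> 0"
proof -
  define g where "g = (deriv ^^ 3) f"
  have g: "g holomorphic_on ball 0 1" unfolding g_def by (intro holomorphic_intros hol) auto
  have deriv_g: "(deriv ^^ m) g 0 = (deriv ^^ (m + 3)) f 0" for m
    by (simp add: g_def funpow_add)
  have "\<forall>\<^sub>F m in sequentially. cmod ((deriv ^^ (m + 3)) f 0 / fact (m + 3) * of_real (real (m + 3) powr (1 + l))) < e"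
    if e: "0 < e" for e
  proof -
    \<comment> \<open>Two factors \<open>4\<close>, from \<open>1 / \<rho> ^ m\<close> and from the
      falling factorial, turn \<open>e / 64\<close> into \<open>e / 4\<close>; the term with
      \<open>M\<close> adds less than another \<open>e / 4\<close>.\<close>
    have "0 < e / 64" using e by simp
    from bound[OF this] obtain M0 where
      M0: "\<forall>z\<in>ball 0 1. cmod (g z) \<le> (e / 64) * cmod (1 - z) powr (l - 3) + M0"
      unfolding g_def by blast
    define M where "M = max M0 0"
    have M: "cmod (g z) \<le> (e / 64) * cmod (1 - z) powr (l - 3) + M" if "z \<in> ball 0 1" for z
      using bspec[OF M0 that] by (simp add: M_def)
    \<comment> \<open>The coefficient \<open>m\<close> of the third derivative belongs to the
      coefficient \<open>n = m + 3\<close> of \<open>f\<close>, whence the radius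
      \<open>1 - 1 / n\<close>. The assumed bound holds eventually because
      \<open>(1 - 1 / n) ^ n\<close> tends to \<open>exp (- 1) > 1 / 4\<close>.\<close>
    have main: "cmod ((deriv ^^ m) g 0 / fact m) \<le> 4 * ((e / 64) * real (m + 3) powr (2 - l) + M)"
      if m: "(1 - 1 / real (m + 3)) ^ (m + 3) \<ge> 1 / 4" for m
    proof -
      define n where "n = real (m + 3)"
      define \<rho> where "\<rho> = 1 - 1 / n"
      have n: "3 \<le> n" by (simp add: n_def)
      have \<rho>: "0 < \<rho>" "\<rho> < 1" using n by (auto simp: \<rho>_def field_simps)
      have "cmod (g z) \<le> ((e / 64) * n powr (1 - l)) / (cmod (1 - z))\<^sup>2 + M" if z: "cmod z = \<rho>" for z
      proof -
        have ge: "1 / n \<le> cmod (1 - z)"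
          using norm_triangle_ineq2[of 1 z] by (simp add: z \<rho>_def)
        have pos: "0 < cmod (1 - z)" using ge n by (smt (verit) divide_pos_pos)
        have "cmod (1 - z) powr (l - 3) = cmod (1 - z) powr (l - 1) * cmod (1 - z) powr - 2"
          by (simp add: powr_add[symmetric])
        also have "\<dots> = cmod (1 - z) powr (l - 1) / (cmod (1 - z))\<^sup>2"
          using pos by (simp add: powr_minus divide_inverse)
        also have "\<dots> \<le> (1 / n) powr (l - 1) / (cmod (1 - z))\<^sup>2"
          by (intro divide_right_mono powr_mono2') (use ge n l in auto)
        also have "(1 / n) powr (l - 1) = n powr (1 - l)"
          using n powr_minus[of n "l - 1"] by (simp add: powr_divide inverse_eq_divide)
        finally show ?thesis
          using M[of z] z \<rho> e by (smt (verit) mult_left_mono divide_nonneg_nonneg mem_ball_0 times_divide_eq_right)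
      qed
      from coefficient_bound_circle[OF g \<rho> this, of m]
      have "cmod ((deriv ^^ m) g 0 / fact m)
          \<le> (((e / 64) * n powr (1 - l)) / (1 - \<rho>\<^sup>2) + M) / \<rho> ^ m" by simp
      also have "\<dots> \<le> ((e / 64) * n powr (2 - l) + M) / (1 / 4)"
      proof (rule frac_le)
        have "1 - \<rho>\<^sup>2 = (1 / n) * (1 + \<rho>)" by (simp add: \<rho>_def power2_eq_square algebra_simps)
        then have "1 / n \<le> 1 - \<rho>\<^sup>2" using \<rho> n by (simp add: field_simps)
        then have "((e / 64) * n powr (1 - l)) / (1 - \<rho>\<^sup>2) \<le> ((e / 64) * n powr (1 - l)) / (1 / n)"
          using n e by (intro frac_le) auto
        also have "\<dots> = (e / 64) * (n powr (1 - l) * n powr 1)" using n by simp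
        also have "\<dots> = (e / 64) * n powr (2 - l)" unfolding powr_add[symmetric] by simp
        finally show "((e / 64) * n powr (1 - l)) / (1 - \<rho>\<^sup>2) + M \<le> (e / 64) * n powr (2 - l) + M"
          by simp
        have "\<rho> ^ (m + 3) \<le> \<rho> ^ m" by (rule power_decreasing) (use \<rho> in auto)
        then show "1 / 4 \<le> \<rho> ^ m" using m unfolding \<rho>_def n_def by linarith
        show "0 \<le> (e / 64) * n powr (2 - l) + M" using e by (simp add: M_def)
      qed simp
      finally show ?thesis by (simp add: n_def)
    qed
    have lim: "(\<lambda>m. (1 - 1 / real (m + 3)) ^ (m + 3)) \<longlonglongrightarrow> exp (- 1)" by real_asymp
    have "1 / 4 < exp (- 1 :: real)"
      using exp_le by (simp add: exp_minus field_simps)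
    then have ev1: "\<forall>\<^sub>F m in sequentially. (1 - 1 / real (m + 3)) ^ (m + 3) \<ge> 1 / 4"
      by (rule eventually_mono[OF order_tendstoD(1)[OF lim]]) (rule less_imp_le)
    have "(\<lambda>m. M * real (m + 3) powr (l - 2)) \<longlonglongrightarrow> 0" using l by real_asymp
    then have ev2: "\<forall>\<^sub>F m in sequentially. M * real (m + 3) powr (l - 2) < e / 64"
      by (rule order_tendstoD(2)) (use e in simp)
    show ?thesis
      using ev1 ev2 eventually_ge_at_top[of 1]
    proof eventually_elim
      case (elim m)
      define n where "n = real (m + 3)"
      have n: "4 \<le> n" using elim(3) by (simp add: n_def)
      have fact: "fact (m + 3) = n * (n - 1) * (n - 2) * (fact m :: real)"
        by (simp add: n_def numeral_3_eq_3 algebra_simps)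
      \<comment> \<open>Returning from the third derivative to \<open>f\<close> divides by
        \<open>n * (n - 1) * (n - 2)\<close>, which for \<open>n \<ge> 4\<close> is at least a
        quarter of the cube of \<open>n\<close>.\<close>
      have "(n - 1) * (n - 2) = n\<^sup>2 / 4 + (3 / 4 * ((n - 4) * n) + 2)"
        by (simp add: power2_eq_square field_simps)
      moreover have "0 \<le> (n - 4) * n" using n by simp
      ultimately have "n\<^sup>2 / 4 \<le> (n - 1) * (n - 2)" by linarith
      then have cube: "n * (n\<^sup>2 / 4) \<le> n * ((n - 1) * (n - 2))"
        by (rule mult_left_mono) (use n in simp)
      have n3: "n * n\<^sup>2 = n powr 3" using n by (simp add: powr_numeral power3_eq_cube power2_eq_square)
      have "cmod ((deriv ^^ (m + 3)) f 0 / fact (m + 3) * of_real (n powr (1 + l)))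
          = cmod ((deriv ^^ m) g 0) / fact (m + 3) * n powr (1 + l)"
        unfolding deriv_g by (simp add: norm_mult norm_divide)
      also have "\<dots> = cmod ((deriv ^^ m) g 0 / fact m) * n powr (1 + l) / (n * ((n - 1) * (n - 2)))"
        unfolding fact by (simp add: norm_divide mult_ac)
      also have "\<dots> \<le> (4 * ((e / 64) * n powr (2 - l) + M)) * n powr (1 + l) / (n * (n\<^sup>2 / 4))"
      proof (rule frac_le)
        have main': "cmod ((deriv ^^ m) g 0 / fact m) \<le> 4 * ((e / 64) * n powr (2 - l) + M)"
          using main[OF elim(1)] by (simp add: n_def)
        then show "cmod ((deriv ^^ m) g 0 / fact m) * n powr (1 + l)
            \<le> (4 * ((e / 64) * n powr (2 - l) + M)) * n powr (1 + l)"
          by (rule mult_right_mono) simp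
        show "0 \<le> (4 * ((e / 64) * n powr (2 - l) + M)) * n powr (1 + l)"
          by (rule mult_nonneg_nonneg[OF order_trans[OF norm_ge_zero main']]) simp
      qed (use cube n in auto)
      also have "\<dots> = 16 * ((e / 64) * (n powr (2 - l) * n powr (1 + l) / n powr 3)
          + M * (n powr (1 + l) / n powr 3))"
        unfolding n3[symmetric] using n by (simp add: field_simps)
      also have "\<dots> = 16 * (e / 64 + M * n powr (l - 2))"
      proof -
        have "n powr (2 - l) * n powr (1 + l) = n powr 3"
          unfolding powr_add[symmetric] by simp
        moreover have "n powr (1 + l) / n powr 3 = n powr (l - 2)"
          unfolding powr_diff[symmetric] by simp
        moreover have "n powr 3 \<noteq> 0" using n by simp
        ultimately show ?thesis by simp
      qed
      also have "\<dots> < e" using elim(2) e by (simp add: n_def)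
      finally show ?case by (simp add: n_def)
    qed
  qed
  then have "(\<lambda>m. (deriv ^^ (m + 3)) f 0 / fact (m + 3) * of_real (real (m + 3) powr (1 + l))) \<longlonglongrightarrow> 0"
    by (intro tendstoI) (simp only: dist_norm diff_zero)
  then show ?thesis by (rule LIMSEQ_offset)
qed

text \<open>Near \<open>1\<close>, Cauchy's inequality on the disc of radius
  \<open>\<kappa> * |1 - z|\<close> costs three powers of \<open>|1 - z|\<close>. The rest of the
  closed unit disc is a compact subset of \<open>U\<close>, on which the third derivative is bounded
  by a constant \<open>M\<close>.\<close>

lemma third_deriv_bound:
  fixes l \<kappa> \<delta> :: real
  assumes hol: "f holomorphic_on U" and "open U"
    and disc: "cball 0 1 - {1} \<subseteq> U"
    and \<kappa>: "0 < \<kappa>" "\<kappa> < 1" and l: "0 < l" "l < 1" and \<delta>: "0 < \<delta>"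
    and sector: "\<And>z. z \<in> ball 0 1 \<Longrightarrow> cmod (1 - z) < \<delta> \<Longrightarrow> cball z (\<kappa> * cmod (1 - z)) \<subseteq> U"
    and small: "\<And>\<eta>. 0 < \<eta> \<Longrightarrow> \<exists>d>0. \<forall>w\<in>U. cmod (1 - w) < d \<longrightarrow> cmod (f w) \<le> \<eta> * cmod (1 - w) powr l"
    and \<eta>: "0 < \<eta>"
  shows "\<exists>M. \<forall>z\<in>ball 0 1. cmod ((deriv ^^ 3) f z) \<le> \<eta> * cmod (1 - z) powr (l - 3) + M"
proof -
  \<comment> \<open>Compensates the factor \<open>12 / \<kappa> ^ 3\<close>: \<open>fact 3\<close>
    and \<open>\<kappa> ^ 3\<close> from Cauchy's inequality, and \<open>2\<close> from
    \<open>(2 * s) powr l \<le> 2 * s powr l\<close>.\<close>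
  define \<eta>' where "\<eta>' = \<eta> * \<kappa> ^ 3 / 12"
  have "0 < \<eta>'" using \<eta> \<kappa> by (simp add: \<eta>'_def)
  then obtain d where d: "0 < d" "\<And>w. w \<in> U \<Longrightarrow> cmod (1 - w) < d \<Longrightarrow> cmod (f w) \<le> \<eta>' * cmod (1 - w) powr l"
    using small[of \<eta>'] by blast
  \<comment> \<open>Half of \<open>d\<close>, because the disc around \<open>z\<close> reaches
    points at distance up to \<open>2 * |1 - z|\<close> from \<open>1\<close>.\<close>
  define d' where "d' = min \<delta> (d / 2)"
  have near: "cmod ((deriv ^^ 3) f z) \<le> \<eta> * cmod (1 - z) powr (l - 3)"
    if z: "z \<in> ball 0 1" "cmod (1 - z) < d'" for z
  proof -
    define s where "s = cmod (1 - z)"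
    have s: "0 < s" "s < \<delta>" "2 * s < d" using z by (auto simp: s_def d'_def)
    have sub: "cball z (\<kappa> * s) \<subseteq> U" using sector[OF z(1)] s by (simp add: s_def)
    have holU: "f holomorphic_on cball z (\<kappa> * s)" using hol sub by (rule holomorphic_on_subset)
    have "cmod ((deriv ^^ 3) f z) \<le> fact 3 * (\<eta>' * (2 * s powr l)) / (\<kappa> * s) ^ 3"
    proof (rule Cauchy_inequality)
      show "f holomorphic_on ball z (\<kappa> * s)" using holU by (rule holomorphic_on_subset) auto
      show "continuous_on (cball z (\<kappa> * s)) f" using holU by (rule holomorphic_on_imp_continuous_on)
      show "0 < \<kappa> * s" using \<kappa> s by simp
      fix w assume w: "cmod (z - w) = \<kappa> * s"
      have "cmod (1 - w) \<le> s + \<kappa> * s" using norm_triangle_ineq[of "1 - z" "z - w"] w by (simp add: s_def)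
      also have "\<dots> \<le> 2 * s" using \<kappa> s by (simp add: algebra_simps)
      finally have le: "cmod (1 - w) \<le> 2 * s" .
      have "w \<in> U" using sub w by (auto simp: dist_norm)
      then have "cmod (f w) \<le> \<eta>' * cmod (1 - w) powr l" using d(2) le s by simp
      also have "\<dots> \<le> \<eta>' * (2 * s) powr l"
        using le l \<open>0 < \<eta>'\<close> by (intro mult_left_mono powr_mono2) auto
      also have "(2 * s) powr l = 2 powr l * s powr l" using s by (simp add: powr_mult)
      also have "\<eta>' * \<dots> \<le> \<eta>' * (2 powr 1 * s powr l)"
        using l \<open>0 < \<eta>'\<close> by (intro mult_left_mono mult_right_mono powr_mono) auto
      finally show "cmod (f w) \<le> \<eta>' * (2 * s powr l)" by simp
    qed
    also have "\<dots> = \<eta> * (s powr l / s powr 3)"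
      using \<kappa> s by (simp add: \<eta>'_def fact_numeral power_mult_distrib powr_numeral)
    also have "\<dots> = \<eta> * s powr (l - 3)" by (simp add: powr_diff)
    finally show ?thesis by (simp add: s_def)
  qed
  define K where "K = cball 0 1 - ball (1::complex) d'"
  have d': "0 < d'" using d(1) \<delta> by (simp add: d'_def)
  have "compact K" unfolding K_def by (intro compact_diff) auto
  moreover have "K \<subseteq> U" using disc d' by (auto simp: K_def)
  then have "continuous_on K ((deriv ^^ 3) f)"
    using holomorphic_higher_deriv[OF hol \<open>open U\<close>, of 3]
    by (meson continuous_on_subset holomorphic_on_imp_continuous_on)
  ultimately have "compact ((deriv ^^ 3) f ` K)" by (rule compact_continuous_image[rotated])
  then obtain M where M: "0 < M" "\<And>z. z \<in> K \<Longrightarrow> cmod ((deriv ^^ 3) f z) \<le> M"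
    using compact_imp_bounded bounded_pos by (metis image_eqI)
  have "cmod ((deriv ^^ 3) f z) \<le> \<eta> * cmod (1 - z) powr (l - 3) + M" if z: "z \<in> ball 0 1" for z
  proof (cases "cmod (1 - z) < d'")
    case True
    then show ?thesis using near[OF z] M(1) by simp
  next
    case False
    then have "z \<in> K" using z by (simp add: K_def dist_norm)
    moreover have "0 \<le> \<eta> * cmod (1 - z) powr (l - 3)" using \<eta> by simp
    ultimately show ?thesis using M(2)[of z] by simp
  qed
  then show ?thesis by blast
qed

section \<open>The cone containing the triangle\<close>

definition right_cone :: "real \<Rightarrow> real \<Rightarrow> complex set" where
  "right_cone m r = {w. \<bar>Im w\<bar> \<le> m * (Re w - r)}"

lemma closed_right_cone: "closed (right_cone m r)"
  unfolding right_cone_def by (intro closed_Collect_le continuous_intros)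

lemma convex_right_cone: "convex (right_cone m r)"
proof (rule convexI)
  fix x y :: complex and u v :: real
  assume xy: "x \<in> right_cone m r" "y \<in> right_cone m r" and uv: "0 \<le> u" "0 \<le> v" "u + v = 1"
  have "\<bar>u * Im x + v * Im y\<bar> \<le> u * \<bar>Im x\<bar> + v * \<bar>Im y\<bar>"
    using uv by (metis abs_mult abs_of_nonneg abs_triangle_ineq)
  also have "\<dots> \<le> u * (m * (Re x - r)) + v * (m * (Re y - r))"
    using xy uv by (intro add_mono mult_left_mono) (auto simp: right_cone_def)
  also have "\<dots> = m * (u * Re x + v * Re y - (u + v) * r)" by (simp add: algebra_simps)
  finally show "u *\<^sub>R x + v *\<^sub>R y \<in> right_cone m r" using uv by (simp add: right_cone_def)
qed

text \<open>The slope is that of the two sides through the left vertex; by convexity of the cone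
  only the three vertices need checking.\<close>

lemma sym_triangle_subset_right_cone:
  assumes "r < a" "0 < b"
  shows "sym_triangle r a b \<subseteq> right_cone (b / (a - r)) r"
  unfolding sym_triangle_def
proof (rule hull_minimal)
  show "convex (right_cone (b / (a - r)) r)" by (rule convex_right_cone)
qed (use assms in \<open>auto simp: right_cone_def\<close>)

lemma right_cone_cball:
  assumes "0 < m" "w \<in> right_cone m 1" "cmod w \<le> 1"
  shows "w = 1"
proof -
  have "0 \<le> m * (Re w - 1)" using assms(2) abs_ge_zero order_trans by (force simp: right_cone_def)
  then have "1 \<le> Re w" using assms(1) by (simp add: zero_le_mult_iff)
  moreover have "Re w \<le> 1" using complex_Re_le_cmod[of w] assms(3) by linarith
  ultimately have "Re w = 1" by linarith
  moreover from this have "Im w = 0" using assms(2) by (simp add: right_cone_def)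
  ultimately show ?thesis by (simp add: complex_eq_iff)
qed

text \<open>With \<open>d = |z - w|\<close>, \<open>Re z < 1\<close> gives
  \<open>Re w - 1 \<le> d\<close>, so the cone condition gives
  \<open>|w - 1| \<le> (1 + m) * d\<close> and hence \<open>|1 - z| \<le> (m + 2) * d\<close>. The
  constant \<open>m + 3\<close> leaves room for strictness.\<close>

lemma right_cone_dist:
  assumes "0 < m" "w \<in> right_cone m 1" "cmod z < 1"
  shows "cmod (1 - z) / (m + 3) < cmod (z - w)"
proof (rule ccontr)
  assume ge: "\<not> cmod (1 - z) / (m + 3) < cmod (z - w)"
  define d where "d = cmod (z - w)"
  have v: "(m + 3) * d \<le> cmod (1 - z)"
    using ge assms(1) by (simp add: d_def field_simps)
  have "Re z < 1" using complex_Re_le_cmod[of z] assms(3) by linarith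
  then have re: "Re w - 1 \<le> d"
    using complex_Re_le_cmod[of "w - z"] by (simp add: d_def norm_minus_commute)
  have nonneg: "0 \<le> m * (Re w - 1)" using assms(2) abs_ge_zero order_trans by (force simp: right_cone_def)
  have "cmod (w - 1) \<le> \<bar>Re w - 1\<bar> + \<bar>Im w\<bar>" using cmod_le[of "w - 1"] by simp
  also have "\<dots> \<le> d + m * d"
  proof (rule add_mono)
    show "\<bar>Re w - 1\<bar> \<le> d" using re nonneg assms(1) by (simp add: zero_le_mult_iff)
    have "\<bar>Im w\<bar> \<le> m * (Re w - 1)" using assms(2) by (simp add: right_cone_def)
    also have "\<dots> \<le> m * d" using re assms(1) by simp
    finally show "\<bar>Im w\<bar> \<le> m * d" .
  qed
  finally have "cmod (1 - z) \<le> d + (d + m * d)"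
    using norm_triangle_ineq[of "1 - w" "w - z"] by (simp add: d_def norm_minus_commute)
  then have "d \<le> 0" using v by (simp add: algebra_simps)
  then have "z = w" by (simp add: d_def)
  then show False using right_cone_cball[OF assms(1,2)] assms(3) by auto
qed

section \<open>Coefficients of the singular term and transfer\<close>

lemma Gamma_neg_unit_interval:
  fixes l :: real
  assumes "0 < l" "l < 1"
  shows "Gamma (- l) < 0"
proof -
  have "- l \<notin> \<int>\<^sub>\<le>\<^sub>0"
  proof
    assume "- l \<in> \<int>\<^sub>\<le>\<^sub>0"
    then obtain n where "- l = real_of_int n" by (elim nonpos_Ints_cases)
    then have "real_of_int (- 1) < real_of_int n" "real_of_int n < real_of_int 0"
      using assms by simp_all
    then show False unfolding of_int_less_iff by linarith
  qed
  from Gamma_plus1[OF this] have "Gamma (1 - l) = - l * Gamma (- l)" by simp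
  moreover have "0 < Gamma (1 - l)" using assms by simp
  ultimately have "0 < l * - Gamma (- l)" by simp
  then show ?thesis using assms by (simp only: zero_less_mult_iff) auto
qed

text \<open>These are the coefficients of \<open>(1 - z) powr l\<close>. The known asymptotics of
  binomial coefficients is rewritten in terms of \<open>powr\<close>, which is possible for
  \<open>n > 0\<close>.\<close>

lemma gbinomial_powr_tendsto:
  fixes l :: real
  shows "(\<lambda>n. (l gchoose n) * (-1) ^ n * real n powr (1 + l)) \<longlonglongrightarrow> inverse (Gamma (- l))"
proof (rule Lim_transform_eventually[OF gbinomial_asymptotic[of l]])
  show "\<forall>\<^sub>F n in sequentially. (l gchoose n) / ((-1) ^ n / exp ((l + 1) * of_real (ln (real n))))
      = (l gchoose n) * (-1) ^ n * real n powr (1 + l)"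
    using eventually_gt_at_top[of 0]
  proof eventually_elim
    case (elim n)
    then show ?case
      by (cases "even n") (simp_all add: powr_def add.commute)
  qed
qed

text \<open>After scaling to radius \<open>1\<close>, the remainder \<open>f\<close> of the
  expansion has negligible coefficients, and those of \<open>- c * (1 - z) powr l\<close> supply the
  limit.\<close>

lemma algebraic_singularity_coefficients:
  fixes g :: "nat \<Rightarrow> real" and H err :: "complex \<Rightarrow> complex" and r \<epsilon> a b c l \<tau> :: real
  defines "D \<equiv> ball 0 (r + \<epsilon>)" and "T \<equiv> sym_triangle r a b"
  assumes r: "0 < r" and \<epsilon>: "0 < \<epsilon>" and ab: "r < a" "0 < b" and l: "0 < l" "l < 1"
    and H: "H analytic_on (D - T)"
    and series: "\<And>z. z \<in> ball 0 r \<Longrightarrow> (\<lambda>n. of_real (g n) * z ^ n) sums H z"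
    and err: "(err \<longlongrightarrow> 0) (at (complex_of_real r) within (D - T))"
    and sing: "\<And>z. z \<in> D - T \<Longrightarrow>
      H z = of_real \<tau> - (of_real c + err z) * (1 - z / of_real r) powr of_real l"
  shows "(\<lambda>n. g n * r ^ n * real n powr (1 + l)) \<longlonglongrightarrow> - c / Gamma (- l)"
proof -
  define m where "m = b / (a - r)"
  have m: "0 < m" using ab by (simp add: m_def)
  \<comment> \<open>The whole cone is removed instead of the triangle. What remains still maps into
    \<open>D - T\<close>, and being outside a cone is what gives discs of radius proportional to
    \<open>|1 - z|\<close>.\<close>
  define U where "U = ball 0 (1 + \<epsilon> / r) - right_cone m 1"
  have "open U" unfolding U_def by (intro open_Diff closed_right_cone open_ball)
  define f where "f z = H (of_real r * z) - of_real \<tau> + of_real c * (1 - z) powr of_real l" for z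
  have map: "of_real r * z \<in> D - T" if "z \<in> U" for z
  proof -
    have "r * cmod z < r * (1 + \<epsilon> / r)" using that r by (intro mult_strict_left_mono) (auto simp: U_def)
    then have "of_real r * z \<in> D" using r by (simp add: D_def norm_mult algebra_simps)
    moreover have "of_real r * z \<notin> T"
    proof
      assume "of_real r * z \<in> T"
      then have "of_real r * z \<in> right_cone m r"
        using sym_triangle_subset_right_cone[OF ab] by (auto simp: T_def m_def)
      then have "r * \<bar>Im z\<bar> \<le> r * (m * (Re z - 1))"
        using r by (simp add: right_cone_def abs_mult algebra_simps)
      then have "z \<in> right_cone m 1" using r by (simp add: right_cone_def)
      then show False using that by (simp add: U_def)
    qed
    ultimately show ?thesis by simp
  qed
  \<comment> \<open>The limit of \<open>err\<close> at \<open>r\<close> is punctured, so the point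
    \<open>1\<close> must be known to lie outside \<open>U\<close>.\<close>
  have ne1: "z \<noteq> 1" if "z \<in> U" for z using that by (auto simp: U_def right_cone_def)
  have f_err: "f z = - err (of_real r * z) * (1 - z) powr of_real l" if "z \<in> U" for z
    using sing[OF map[OF that]] r by (simp add: f_def algebra_simps)
  have f_hol: "f holomorphic_on U"
  proof -
    have "(\<lambda>z. H (of_real r * z)) holomorphic_on U"
      using holomorphic_on_compose_gen[of "\<lambda>z. of_real r * z" U H "D - T"]
        analytic_imp_holomorphic[OF H] map
      by (auto simp: o_def intro!: holomorphic_intros)
    \<comment> \<open>The branch cut of \<open>(1 - z) powr l\<close>, the real ray from
      \<open>1\<close> to the right, lies in the removed cone.\<close>
    moreover have "1 - z \<notin> \<real>\<^sub>\<le>\<^sub>0" if "z \<in> U" for z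
    proof
      assume "1 - z \<in> \<real>\<^sub>\<le>\<^sub>0"
      then have "Im z = 0" "1 \<le> Re z" by (auto simp: complex_nonpos_Reals_iff)
      then show False using that m by (simp add: U_def right_cone_def)
    qed
    ultimately show ?thesis unfolding f_def by (intro holomorphic_intros)
  qed
  have disc: "cball 0 1 - {1} \<subseteq> U"
    using right_cone_cball[OF m] le_less_trans[of _ 1 "1 + \<epsilon> / r"] \<epsilon> r by (auto simp: U_def)
  then have ball: "ball 0 1 \<subseteq> U" by auto
  have bound: "\<exists>M. \<forall>z\<in>ball 0 1. cmod ((deriv ^^ 3) f z) \<le> \<eta> * cmod (1 - z) powr (l - 3) + M"
    if "0 < \<eta>" for \<eta>
  proof (rule third_deriv_bound[OF f_hol \<open>open U\<close> disc _ _ l _ _ _ that])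
    \<comment> \<open>\<open>\<kappa> = 1 / (m + 3)\<close> comes from
      \<open>right_cone_dist\<close>. With \<open>\<delta> = \<epsilon> / r\<close> the discs stay
      in the large disc, as their radius is at most \<open>|1 - z|\<close>.\<close>
    show "0 < 1 / (m + 3)" "1 / (m + 3) < 1" "0 < \<epsilon> / r" using m \<epsilon> r by simp_all
    fix z assume z: "z \<in> ball 0 1" "cmod (1 - z) < \<epsilon> / r"
    show "cball z (1 / (m + 3) * cmod (1 - z)) \<subseteq> U"
    proof
      fix w assume w: "w \<in> cball z (1 / (m + 3) * cmod (1 - z))"
      then have d: "cmod (z - w) \<le> cmod (1 - z) / (m + 3)" by (simp add: dist_norm)
      also have "\<dots> \<le> cmod (1 - z) / 1" using m by (intro frac_le) auto
      finally have "cmod w < 1 + \<epsilon> / r"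
        using z norm_triangle_ineq4[of z "z - w"] by simp
      moreover have "w \<notin> right_cone m 1" using right_cone_dist[OF m, of w z] d z(1) by auto
      ultimately show "w \<in> U" by (simp add: U_def)
    qed
  next
    fix \<eta> :: real assume "0 < \<eta>"
    from tendstoD[OF err this] obtain d where d: "0 < d"
      "\<And>x. x \<in> D - T \<Longrightarrow> x \<noteq> of_real r \<Longrightarrow> dist x (of_real r) < d \<Longrightarrow> cmod (err x) < \<eta>"
      unfolding eventually_at dist_norm[of "err _"] diff_zero by blast
    have "cmod (f w) \<le> \<eta> * cmod (1 - w) powr l" if w: "w \<in> U" "cmod (1 - w) < d / r" for w
    proof -
      have "dist (of_real r * w) (of_real r) = r * cmod (1 - w)"
        using r norm_mult[of "of_real r" "w - 1"] by (simp add: dist_norm norm_minus_commute algebra_simps)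
      also have "\<dots> < d" using w(2) r by (simp add: field_simps)
      finally have "cmod (err (of_real r * w)) < \<eta>"
        using d(2)[OF map[OF w(1)]] ne1[OF w(1)] r by simp
      then show ?thesis
        unfolding f_err[OF w(1)] norm_mult norm_minus_cancel
        by (simp add: norm_powr_real_powr' mult_right_mono)
    qed
    then show "\<exists>d>0. \<forall>w\<in>U. cmod (1 - w) < d \<longrightarrow> cmod (f w) \<le> \<eta> * cmod (1 - w) powr l"
      using d(1) r by (intro exI[of _ "d / r"]) auto
  qed
  have f_ball: "f holomorphic_on ball 0 1" using f_hol ball by (rule holomorphic_on_subset)
  \<comment> \<open>The coefficients of \<open>f\<close>: \<open>\<tau>\<close> enters only at
    \<open>n = 0\<close>, and the sign \<open>(-1) ^ n\<close> comes from the binomial series at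
    \<open>- z\<close>.\<close>
  define e where "e n = g n * r ^ n - (if n = 0 then \<tau> else 0) + c * ((l gchoose n) * (-1) ^ n)" for n
  have choose: "(complex_of_real l gchoose n) = of_real (l gchoose n)" for n
    by (simp add: gbinomial_prod_rev)
  have f_sums: "(\<lambda>n. complex_of_real (e n) * z ^ n) sums f z" if z: "z \<in> ball 0 1" for z
  proof -
    have "of_real r * z \<in> ball 0 r" using z r by (simp add: norm_mult)
    from series[OF this] have 1: "(\<lambda>n. of_real (g n * r ^ n) * z ^ n) sums H (of_real r * z)"
      by (simp add: power_mult_distrib mult.assoc)
    have 2: "(\<lambda>n. if n = 0 then of_real \<tau> * z ^ n else 0) sums (of_real \<tau> * z ^ 0)"
      by (rule sums_single)
    have "(\<lambda>n. (complex_of_real l gchoose n) * (- z) ^ n) sums (1 + - z) powr of_real l"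
      by (rule gen_binomial_complex) (use z in simp)
    moreover have "(- z) ^ n = of_real ((-1) ^ n) * z ^ n" for n
      using power_mult_distrib[of "-1" z n] by simp
    ultimately have 3: "(\<lambda>n. of_real ((l gchoose n) * (-1) ^ n) * z ^ n) sums (1 - z) powr of_real l"
      by (simp add: choose mult.assoc)
    have "(\<lambda>n. of_real (g n * r ^ n) * z ^ n - (if n = 0 then of_real \<tau> * z ^ n else 0)
        + of_real c * (of_real ((l gchoose n) * (-1) ^ n) * z ^ n)) sums
        (H (of_real r * z) - of_real \<tau> * z ^ 0 + of_real c * (1 - z) powr of_real l)"
      by (intro sums_add sums_diff sums_mult 1 2 3)
    also have "(\<lambda>n. of_real (g n * r ^ n) * z ^ n - (if n = 0 then of_real \<tau> * z ^ n else 0)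
        + of_real c * (of_real ((l gchoose n) * (-1) ^ n) * z ^ n)) = (\<lambda>n. of_real (e n) * z ^ n)"
      by (rule ext) (simp add: e_def algebra_simps)
    finally show ?thesis by (simp add: f_def)
  qed
  have "f has_fps_expansion Abs_fps (\<lambda>n. of_real (e n))"
  proof (rule has_fps_expansionI)
    have "\<forall>\<^sub>F z in nhds 0. z \<in> ball (0::complex) 1" by (rule eventually_nhds_in_open) auto
    then show "\<forall>\<^sub>F z in nhds 0. (\<lambda>n. fps_nth (Abs_fps (\<lambda>n. complex_of_real (e n))) n * z ^ n) sums f z"
      by (rule eventually_mono) (simp add: f_sums)
  qed
  from fps_nth_fps_expansion[OF this]
  have "(deriv ^^ n) f 0 / fact n = of_real (e n)" for n by simp
  with coefficients_little_o[OF f_ball l bound]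
  have "(\<lambda>n. complex_of_real (e n * real n powr (1 + l))) \<longlonglongrightarrow> of_real 0" by simp
  then have "(\<lambda>n. e n * real n powr (1 + l)) \<longlonglongrightarrow> 0" by (rule tendsto_of_real_iff[THEN iffD1])
  from tendsto_diff[OF this tendsto_mult[OF tendsto_const[of c] gbinomial_powr_tendsto[of l]]]
  have "(\<lambda>n. e n * real n powr (1 + l) - c * ((l gchoose n) * (-1) ^ n * real n powr (1 + l)))
      \<longlonglongrightarrow> - c / Gamma (- l)" by (simp add: divide_inverse)
  moreover have "\<forall>\<^sub>F n in sequentially.
      e n * real n powr (1 + l) - c * ((l gchoose n) * (-1) ^ n * real n powr (1 + l))
        = g n * r ^ n * real n powr (1 + l)"
    using eventually_gt_at_top[of 0] by eventually_elim (simp add: e_def algebra_simps)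
  ultimately show ?thesis by (rule Lim_transform_eventually)
qed

section \<open>Asymptotics of the class\<close>

lemma summable_of_powr_limit:
  fixes a :: "nat \<Rightarrow> real"
  assumes "(\<lambda>n. a n * real n powr (1 + l)) \<longlonglongrightarrow> K" "0 < l"
  shows "summable a"
proof -
  obtain B where B: "\<bar>a n * real n powr (1 + l)\<bar> \<le> B" for n
    using convergent_imp_Bseq[OF convergentI[OF assms(1)]] unfolding Bseq_def by auto
  have "\<forall>\<^sub>F n in sequentially. norm (a n) \<le> B * real n powr - (1 + l)"
    using eventually_gt_at_top[of 0]
  proof eventually_elim
    case (elim n)
    then show ?case using B[of n] unfolding abs_mult powr_minus by (simp add: field_simps)
  qed
  moreover have "summable (\<lambda>n. B * real n powr - (1 + l))"
    using assms(2) by (intro summable_mult) (subst summable_real_powr_iff, simp)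
  ultimately show ?thesis by (rule summable_comparison_test_ev)
qed

text \<open>Tannery's theorem with dominating terms \<open>g n * r ^ n\<close>; it identifies the
  radial limit with the value of the series at \<open>r\<close>, on the boundary of its
  disc.\<close>

lemma suminf_eq_radial_limit:
  fixes g :: "nat \<Rightarrow> real" and G :: "real \<Rightarrow> complex"
  assumes "0 < r" "\<And>n. 0 \<le> g n" "summable (\<lambda>n. g n * r ^ n)"
    and G: "\<And>x. 0 < x \<Longrightarrow> x < r \<Longrightarrow> (\<lambda>n. of_real (g n) * of_real x ^ n) sums G x"
    and lim: "(G \<longlongrightarrow> of_real t) (at_left r)"
  shows "(\<lambda>n. g n * r ^ n) sums t"
proof -
  have ev: "\<forall>\<^sub>F x in at_left r. x \<in> {0<..<r}" by (rule eventually_at_left_real[OF assms(1)])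
  have "((\<lambda>x. suminf (\<lambda>n. complex_of_real (g n * x ^ n))) \<longlongrightarrow>
      suminf (\<lambda>n. complex_of_real (g n * r ^ n))) (at_left r)"
  proof (rule tannerys_theorem[THEN conjunct2, THEN conjunct2])
    show "((\<lambda>x. complex_of_real (g n * x ^ n)) \<longlongrightarrow> complex_of_real (g n * r ^ n)) (at_left r)" for n
      by (intro tendsto_intros)
    show "\<forall>\<^sub>F (n, x) in sequentially \<times>\<^sub>F at_left r. norm (complex_of_real (g n * x ^ n)) \<le> g n * r ^ n"
      using eventually_prodI[OF eventually_True ev]
    proof (rule eventually_mono)
      fix p :: "nat \<times> real" assume "True \<and> snd p \<in> {0<..<r}"
      then have "snd p ^ fst p \<le> r ^ fst p" "0 \<le> snd p ^ fst p" by (auto intro: power_mono)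
      then show "case p of (n, x) \<Rightarrow> norm (complex_of_real (g n * x ^ n)) \<le> g n * r ^ n"
        using assms(2) unfolding case_prod_beta norm_of_real
        by (simp add: abs_mult mult_left_mono)
    qed
  qed (use assms(3) in auto)
  moreover have "\<forall>\<^sub>F x in at_left r. suminf (\<lambda>n. complex_of_real (g n * x ^ n)) = G x"
    using ev by eventually_elim (use G in \<open>simp add: sums_iff\<close>)
  ultimately have "(G \<longlongrightarrow> suminf (\<lambda>n. complex_of_real (g n * r ^ n))) (at_left r)"
    by (rule Lim_transform_eventually)
  then have "suminf (\<lambda>n. complex_of_real (g n * r ^ n)) = of_real t"
    using lim by (rule tendsto_unique[OF trivial_limit_at_left_real])
  then have "suminf (\<lambda>n. g n * r ^ n) = t"
    unfolding suminf_of_real[OF assms(3), symmetric] of_real_eq_iff .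
  then show ?thesis using assms(3) by (simp add: sums_iff)
qed

lemma asymp_equiv_of_scaled_limits:
  fixes f g w :: "nat \<Rightarrow> real"
  assumes "(\<lambda>n. f n * w n) \<longlonglongrightarrow> L" "(\<lambda>n. g n * w n) \<longlonglongrightarrow> L" "L \<noteq> 0"
    and "\<forall>\<^sub>F n in sequentially. w n \<noteq> 0"
  shows "f \<sim>[sequentially] g"
proof (rule asymp_equivI')
  have "(\<lambda>n. (f n * w n) / (g n * w n)) \<longlonglongrightarrow> L / L"
    by (intro tendsto_divide assms)
  then have "(\<lambda>n. (f n * w n) / (g n * w n)) \<longlonglongrightarrow> 1" using assms(3) by simp
  moreover have "\<forall>\<^sub>F n in sequentially. (f n * w n) / (g n * w n) = f n / g n"
    using assms(4) by eventually_elim simp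
  ultimately show "(\<lambda>n. f n / g n) \<longlonglongrightarrow> 1" by (rule Lim_transform_eventually)
qed

theorem theorem4p3:
  fixes C :: perm_family and r \<tau> \<epsilon> a b c lam :: real
    and H err :: "complex \<Rightarrow> complex" and D T :: "complex set"
  assumes "permutation_class C" and "sum_closed C"
    and "fps_conv_radius (indec_gf C) = ereal r" and "r > 0"
    and "((\<lambda>x. eval_fps (indec_gf C) (complex_of_real x)) \<longlongrightarrow> complex_of_real \<tau>) (at_left r)"
    and "\<tau> < 1"
    and "\<And>z. z \<in> cball 0 r \<Longrightarrow> z \<noteq> complex_of_real r \<Longrightarrow> fps_regular_at (indec_gf C) z"
    and "\<epsilon> > 0" and "D = ball 0 (r + \<epsilon>)"
    and "r < a" and "0 < b" and "T = sym_triangle r a b"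
    and "c > 0" and "0 < lam" and "lam < 1"
    and "H analytic_on (D - T)"
    and "\<And>z. z \<in> ball 0 r \<Longrightarrow> H z = eval_fps (indec_gf C) z"
    and "(err \<longlongrightarrow> 0) (at (complex_of_real r) within (D - T))"
    and "\<And>z. z \<in> D - T \<Longrightarrow>
           H z = of_real \<tau> - (of_real c + err z) * (1 - z / of_real r) powr of_real lam"
  shows "(\<lambda>n. real (card (periodic_sums C n))) \<sim>[sequentially]
           (\<lambda>n. (1 - \<tau>) * real n * real (card (C n)))
         \<and> (\<lambda>n. real (card (indecomposables C n))) \<sim>[sequentially]
           (\<lambda>n. (1 - \<tau>)\<^sup>2 * real (card (C n)))"
proof -
  interpret sum_closed_class C by unfold_locales (fact assms(1,2))+
  \<comment> \<open>\<open>sum_indecomposable\<close> holds for the empty permutation, so the value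
    at \<open>0\<close> is set to \<open>0\<close> explicitly.\<close>
  define g where "g n = (if n = 0 then 0 else real (card (indecomposables C n)))" for n
  define x where "x n = g n * r ^ n" for n
  define \<phi> where "\<phi> n = real (card (C n)) * r ^ n" for n
  define K where "K = - c / Gamma (- lam)"
  \<comment> \<open>Positivity, due to \<open>Gamma (- lam) < 0\<close>, makes the limits below
    nonzero, so that equal limits give asymptotic equivalence.\<close>
  have K: "K > 0"
    using divide_pos_neg[OF assms(13) Gamma_neg_unit_interval[OF assms(14,15)]] by (simp add: K_def)
  have nth: "fps_nth (indec_gf C) n = of_real (g n)" for n
    by (simp add: indec_gf_def g_def)
  have series: "(\<lambda>n. of_real (g n) * z ^ n) sums eval_fps (indec_gf C) z" if "z \<in> ball 0 r" for z
    using sums_eval_fps[of z "indec_gf C"] that assms(3) by (simp add: nth)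
  have "(\<lambda>n. g n * r ^ n * real n powr (1 + lam)) \<longlonglongrightarrow> - c / Gamma (- lam)"
    by (rule algebraic_singularity_coefficients[where H = H and err = err and \<epsilon> = \<epsilon> and a = a and b = b
          and \<tau> = \<tau>])
       (use assms series in auto)
  then have lim: "(\<lambda>n. x n * real n powr (1 + lam)) \<longlonglongrightarrow> K"
    by (simp add: x_def K_def)
  have "x sums \<tau>"
    unfolding x_def
  proof (rule suminf_eq_radial_limit[OF assms(4) _ _ _ assms(5)])
    show "summable (\<lambda>n. g n * r ^ n)"
      using summable_of_powr_limit[OF lim assms(14)] by (simp add: x_def)
    show "(\<lambda>n. of_real (g n) * of_real y ^ n) sums eval_fps (indec_gf C) (complex_of_real y)"
      if "0 < y" "y < r" for y
      by (rule series) (use that in simp)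
  qed (simp add: g_def)
  \<comment> \<open>An empty family would have generating function \<open>0\<close>, whose radius of
    convergence is infinite and not \<open>r\<close>.\<close>
  have "\<exists>n. C n \<noteq> {}"
  proof (rule ccontr)
    assume "\<nexists>n. C n \<noteq> {}"
    then have "indec_gf C = 0" by (intro fps_ext) (simp add: indec_gf_def indecomposables_def)
    then show False using assms(3) by simp
  qed
  then have "card (C 0) = 1" using card_C_0 by blast
  then have \<phi>0: "\<phi> 0 = 1" by (simp add: \<phi>_def)
  have x_\<phi>: "x k * \<phi> (n - k) = real (card (indecomposables C k) * card (C (n - k))) * r ^ n"
    if "k \<in> {1..n}" for k n
    using that by (simp add: x_def g_def \<phi>_def power_add[symmetric])
  have split: "(\<Sum>i\<le>n. h i * (x i * \<phi> (n - i))) = (\<Sum>i=1..n. h i * (x i * \<phi> (n - i)))" for h n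
    by (rule sum.mono_neutral_right) (auto simp: x_def g_def)
  have \<phi>_rec: "\<phi> n = (\<Sum>i\<le>n. x i * \<phi> (n - i))" if "0 < n" for n
  proof -
    have "\<phi> n = (\<Sum>k=1..n. 1 * (x k * \<phi> (n - k)))"
      unfolding \<phi>_def[of n] card_C[OF that] of_nat_sum sum_distrib_right
      by (rule sum.cong) (use x_\<phi> in auto)
    then show ?thesis unfolding split[symmetric] by simp
  qed
  have periodic: "real (card (periodic_sums C n)) * r ^ n = (\<Sum>i\<le>n. real i * x i * \<phi> (n - i))"
    if "0 < n" for n
  proof -
    have "real (card (periodic_sums C n)) * r ^ n = (\<Sum>k=1..n. real k * (x k * \<phi> (n - k)))"
      unfolding card_periodic_sums[OF that] of_nat_sum sum_distrib_right
      by (rule sum.cong) (use x_\<phi> in auto)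
    then show ?thesis unfolding split[symmetric] by (simp add: mult.assoc)
  qed
  have x: "0 \<le> x n" "x 0 = 0" for n using assms(4) by (simp_all add: x_def g_def)
  note asym = renewal_asymptotics[OF x \<open>x sums \<tau>\<close> assms(6,14,15) lim \<phi>0 \<phi>_rec]
  have ev: "\<forall>\<^sub>F n in sequentially. r ^ n * real n powr p \<noteq> 0" for p
    using eventually_gt_at_top[of 0] by eventually_elim (use assms(4) in simp)
  have t: "1 - \<tau> \<noteq> 0" using assms(6) by simp
  have 1: "(\<lambda>n. real (card (periodic_sums C n)) * (r ^ n * real n powr lam)) \<longlonglongrightarrow> K / (1 - \<tau>)"
  proof (rule Lim_transform_eventually[OF asym(2)])
    show "\<forall>\<^sub>F n in sequentially. (\<Sum>i\<le>n. real i * x i * \<phi> (n - i)) * real n powr lam =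
        real (card (periodic_sums C n)) * (r ^ n * real n powr lam)"
      using eventually_gt_at_top[of 0] by eventually_elim (simp add: periodic[symmetric])
  qed
  \<comment> \<open>The factor \<open>n\<close> in the first claim is taken out of
    \<open>real n powr (1 + lam)\<close>, which leaves the weight \<open>real n powr lam\<close>
    used for the periodic sums.\<close>
  have "(\<lambda>n. (1 - \<tau>) * (\<phi> n * real n powr (1 + lam))) \<longlonglongrightarrow> (1 - \<tau>) * (K / (1 - \<tau>)\<^sup>2)"
    by (intro tendsto_intros asym)
  then have 2: "(\<lambda>n. ((1 - \<tau>) * real n * real (card (C n))) * (r ^ n * real n powr lam)) \<longlonglongrightarrow> K / (1 - \<tau>)"
    using t by (simp add: \<phi>_def powr_add mult_ac power2_eq_square)
  have 3: "(\<lambda>n. real (card (indecomposables C n)) * (r ^ n * real n powr (1 + lam))) \<longlonglongrightarrow> K"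
  proof (rule Lim_transform_eventually[OF lim])
    show "\<forall>\<^sub>F n in sequentially. x n * real n powr (1 + lam) =
        real (card (indecomposables C n)) * (r ^ n * real n powr (1 + lam))"
      using eventually_gt_at_top[of 0] by eventually_elim (simp add: x_def g_def)
  qed
  have "(\<lambda>n. (1 - \<tau>)\<^sup>2 * (\<phi> n * real n powr (1 + lam))) \<longlonglongrightarrow> (1 - \<tau>)\<^sup>2 * (K / (1 - \<tau>)\<^sup>2)"
    by (intro tendsto_intros asym)
  then have 4: "(\<lambda>n. ((1 - \<tau>)\<^sup>2 * real (card (C n))) * (r ^ n * real n powr (1 + lam))) \<longlonglongrightarrow> K"
    using t by (simp add: \<phi>_def mult_ac)
  show ?thesis
    using asymp_equiv_of_scaled_limits[OF 1 2 _ ev] asymp_equiv_of_scaled_limits[OF 3 4 _ ev] K t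
    by simp
qed

end
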